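(* Let $w=w(t)$, $t\ge 0$, be a standard Brownian motion, let $T>0$, $\beta,\gamma\in(0,1)$ and $X_0\in\mathbb{R}$. If $\beta-\gamma>-\frac12$, then $$X(t)=X_0+\frac{1}{\Gamma(1+\beta-\gamma)}\int_0^t (t-s)^{\beta-\gamma}\,dw(s)$$ is the unique classical solution on $[0,T]$ of the equation $$\partial_t^{\beta}X(t)=\partial_t^{\gamma}w(t),\quad t>0,\qquad X(0)=X_0.$$
   Context: For $p>0$ and a function $f$ on $(0,\infty)$ with limit $f(0)=f(0+)$ at zero, $J^{p}f(t)=\frac{1}{\Gamma(p)}\int_0^t(t-s)^{p-1}(f(s)-f(0))\,ds$, and for $\beta\in(0,1)$, $\partial_t^{\beta}f(t)=\frac{d}{dt}J^{1-\beta}f(t)$. A classical solution of the equation $\partial_t^{\beta}X=\partial_t^{\gamma}w$, $X(0)=X_0$, on $[0,T]$ is a continuous process $X=X(t)$ with $X(0)=X_0$ such that $\mathbb{P}\big(J^{1-\beta}X(t)=J^{1-\gamma}w(t),\ t\in[0,T]\big)=1$. Uniqueness is up to indistinguishability, and the stochastic integral is understood as its continuous version. *)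

theory Defs
  imports "HOL-Probability.Probability"
begin

locale standard_brownian_motion = prob_space M
  for M :: "'a measure" and w :: "real \<Rightarrow> 'a \<Rightarrow> real" +
  assumes measurable_w: "\<And>t. 0 \<le> t \<Longrightarrow> w t \<in> borel_measurable M"
    and start_zero: "AE \<omega> in M. w 0 \<omega> = 0"
    and normal_increments: "\<And>s t. 0 \<le> s \<Longrightarrow> s < t \<Longrightarrow>
      distributed M lborel (\<lambda>\<omega>. w t \<omega> - w s \<omega>) (\<lambda>x. ennreal (normal_density 0 (sqrt (t - s)) x))"
    and indep_increments: "\<And>(n::nat) \<tau>. 0 \<le> \<tau> 0 \<Longrightarrow> (\<forall>i<n. \<tau> i < \<tau> (Suc i)) \<Longrightarrow>
      indep_vars (\<lambda>_. borel) (\<lambda>i \<omega>. w (\<tau> (Suc i)) \<omega> - w (\<tau> i) \<omega>) {..<n}"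
    and continuous_paths: "AE \<omega> in M. continuous_on {0..} (\<lambda>t. w t \<omega>)"

(* J^p f(t). The value f(0) is by convention the limit f(0+), so only f on (0,\<infinity>) matters. *)
definition frac_J :: "real \<Rightarrow> (real \<Rightarrow> real) \<Rightarrow> real \<Rightarrow> real" where
  "frac_J p f t =
     1 / Gamma p * (LINT s:{0..t}|lborel. (t - s) powr (p - 1) * (f s - Lim (at_right 0) f))"

definition continuous_process :: "'a measure \<Rightarrow> real \<Rightarrow> (real \<Rightarrow> 'a \<Rightarrow> real) \<Rightarrow> bool" where
  "continuous_process M T X \<longleftrightarrow>
     (\<forall>t\<in>{0..T}. X t \<in> borel_measurable M) \<and>
     (AE \<omega> in M. continuous_on {0..T} (\<lambda>t. X t \<omega>))"

definition indistinguishable :: "'a measure \<Rightarrow> real \<Rightarrow> (real \<Rightarrow> 'a \<Rightarrow> real) \<Rightarrow> (real \<Rightarrow> 'a \<Rightarrow> real) \<Rightarrow> bool" where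
  "indistinguishable M T X Y \<longleftrightarrow> (AE \<omega> in M. \<forall>t\<in>{0..T}. X t \<omega> = Y t \<omega>)"

(* Classical solution on [0,T] of D^\<beta> X = D^\<gamma> w, X(0) = X0, where D^\<beta> = d/dt J^(1-\<beta>):
   the equation is understood in its integrated form. *)
definition classical_solution ::
  "'a measure \<Rightarrow> (real \<Rightarrow> 'a \<Rightarrow> real) \<Rightarrow> real \<Rightarrow> real \<Rightarrow> real \<Rightarrow> real \<Rightarrow> (real \<Rightarrow> 'a \<Rightarrow> real) \<Rightarrow> bool" where
  "classical_solution M w T \<beta> \<gamma> X0 X \<longleftrightarrow>
     continuous_process M T X \<and>
     (AE \<omega> in M. X 0 \<omega> = X0) \<and>
     (AE \<omega> in M. \<forall>t\<in>{0..T}. frac_J (1 - \<beta>) (\<lambda>s. X s \<omega>) t = frac_J (1 - \<gamma>) (\<lambda>s. w s \<omega>) t)"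

definition is_partition :: "real \<Rightarrow> nat \<Rightarrow> (nat \<Rightarrow> real) \<Rightarrow> bool" where
  "is_partition t n \<tau> \<longleftrightarrow> \<tau> 0 = 0 \<and> \<tau> n = t \<and> (\<forall>i<n. \<tau> i < \<tau> (Suc i))"

definition step_function :: "nat \<Rightarrow> (nat \<Rightarrow> real) \<Rightarrow> (nat \<Rightarrow> real) \<Rightarrow> real \<Rightarrow> real" where
  "step_function n \<tau> c s = (\<Sum>i<n. c i * indicator {\<tau> i<..\<tau> (Suc i)} s)"

definition step_integral ::
  "(real \<Rightarrow> 'a \<Rightarrow> real) \<Rightarrow> nat \<Rightarrow> (nat \<Rightarrow> real) \<Rightarrow> (nat \<Rightarrow> real) \<Rightarrow> 'a \<Rightarrow> real" where
  "step_integral w n \<tau> c \<omega> = (\<Sum>i<n. c i * (w (\<tau> (Suc i)) \<omega> - w (\<tau> i) \<omega>))"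

(* I is (a version of) the stochastic integral of the deterministic square integrable function f
   over [0,t] with respect to w: an L2 limit of integrals of step functions that converge to f in
   L2([0,t]). By the Ito isometry the limit does not depend on the approximating sequence, so I is
   determined up to almost sure equality. *)
definition has_wiener_integral ::
  "'a measure \<Rightarrow> (real \<Rightarrow> 'a \<Rightarrow> real) \<Rightarrow> real \<Rightarrow> (real \<Rightarrow> real) \<Rightarrow> ('a \<Rightarrow> real) \<Rightarrow> bool" where
  "has_wiener_integral M w t f I \<longleftrightarrow>
     set_borel_measurable lborel {0..t} f \<and> set_integrable lborel {0..t} (\<lambda>s. (f s)\<^sup>2) \<and>
     I \<in> borel_measurable M \<and> integrable M (\<lambda>\<omega>. (I \<omega>)\<^sup>2) \<and>
     (\<exists>N \<tau> c. (\<forall>k::nat. is_partition t (N k) (\<tau> k)) \<and>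
        (\<lambda>k. LINT s:{0..t}|lborel. (step_function (N k) (\<tau> k) (c k) s - f s)\<^sup>2) \<longlonglongrightarrow> 0 \<and>
        (\<lambda>k. LINT \<omega>|M. (step_integral w (N k) (\<tau> k) (c k) \<omega> - I \<omega>)\<^sup>2) \<longlonglongrightarrow> 0)"

(* Z is a continuous version on [0,T] of the process t \<mapsto> \<integral>_0^t K(t,s) dw(s). *)
definition continuous_wiener_integral ::
  "'a measure \<Rightarrow> (real \<Rightarrow> 'a \<Rightarrow> real) \<Rightarrow> real \<Rightarrow> (real \<Rightarrow> real \<Rightarrow> real) \<Rightarrow> (real \<Rightarrow> 'a \<Rightarrow> real) \<Rightarrow> bool" where
  "continuous_wiener_integral M w T K Z \<longleftrightarrow>
     continuous_process M T Z \<and> (\<forall>t\<in>{0..T}. has_wiener_integral M w t (K t) (Z t))"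

end

theory Submission
  imports Defs
begin

text \<open>Write \<open>\<alpha> = \<beta> - \<gamma>\<close>. The whole problem is solved path by path: for a Hoelder continuous path \<open>f\<close> with
\<open>f 0 = 0\<close> and exponent larger than \<open>- \<alpha>\<close>, the integral of \<open>(t - s) powr \<alpha>\<close> against \<open>df(s)\<close>, integrated
by parts with the primitive \<open>f s - f t\<close> of \<open>df(s)\<close>, becomes the absolutely convergent expression
\<open>t powr \<alpha> * f t - \<alpha> * (integral over u in [0, t] of u powr (\<alpha> - 1) * (f t - f (t - u)))\<close>, called \<open>marchaud\<close> below.
It covers fractional integration (\<open>\<alpha> > 0\<close>), the identity (\<open>\<alpha> = 0\<close>) and fractional differentiation
(\<open>\<alpha> < 0\<close>) at once. Brownian paths are Hoelder of every order below \<open>1/2\<close> (\<open>AE_holder\<close>), which is why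
\<open>\<alpha> > - 1/2\<close> is the right condition.

The equation. Let \<open>J\<^sup>p\<close> be the Riemann--Liouville integral. Applied to the Marchaud form \<open>Z\<close> of \<open>f\<close>, it
satisfies \<open>J\<^sup>p Z = \<Gamma>(1 + \<alpha>) J\<^sup>p\<^sup>+\<^sup>\<alpha> f\<close> (\<open>rl_marchaud\<close>), so with \<open>p = 1 - \<beta>\<close> the process \<open>X0 + Z / \<Gamma>(1 + \<alpha>)\<close> solves
the equation. To avoid singular Beta integrals when \<open>\<alpha> < 0\<close>, this is first shown for \<open>p = 1\<close>, where it is
Fubini and one integration by parts; the semigroup law \<open>J\<^sup>p J\<^sup>q = J\<^sup>p\<^sup>+\<^sup>q\<close> moves it to \<open>J\<^sup>1\<close> of both sides for
general \<open>p\<close>, and \<open>J\<^sup>1\<close> can be undone by differentiation. Uniqueness is the same argument: \<open>J\<^sup>1\<^sup>-\<^sup>\<beta>\<close> is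
injective on continuous functions because \<open>J\<^sup>\<beta> J\<^sup>1\<^sup>-\<^sup>\<beta> = J\<^sup>1\<close>.

The stochastic integral. The step integrals of the left end point approximations of
\<open>(t - s) powr \<alpha>\<close> on uniform partitions are Riemann sums of the path. By summation by parts they converge
to the Marchaud form on every Hoelder path (\<open>riemann_sums_tendsto_marchaud\<close>). By the isometry
(\<open>step_integral_isometry\<close>) they are also Cauchy in \<open>L\<^sup>2\<close>, so Fatou's lemma turns the pathwise limit into an
\<open>L\<^sup>2\<close> limit (\<open>has_wiener_integralI\<close>). Hence the Marchaud form of the Brownian path is a continuous version
of the Wiener integral, and any other continuous version agrees with it at all rational times, hence
everywhere, outside one null set.\<close>

section \<open>Riemann--Liouville integrals\<close>

text \<open>The classical integral \<open>J\<^sup>p\<close>, without the subtraction of \<open>f(0+)\<close> that \<open>frac_J\<close> performs: in this form the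
semigroup law holds for all continuous functions.\<close>

definition rl_integral :: "real \<Rightarrow> (real \<Rightarrow> real) \<Rightarrow> real \<Rightarrow> real" where
  "rl_integral p f t = 1 / Gamma p * (LINT s:{0..t}|lborel. (t - s) powr (p - 1) * f s)"

lemma nonneg_has_integral_lborel:
  fixes f :: "real \<Rightarrow> real"
  assumes "f \<in> borel_measurable borel" "\<And>x. x \<in> {a..b} \<Longrightarrow> 0 \<le> f x" "(f has_integral I) {a..b}"
  shows "set_integrable lborel {a..b} f" "(LINT x:{a..b}|lborel. f x) = I"
proof -
  have "f absolutely_integrable_on {a..b}"
    using assms by (intro nonnegative_absolutely_integrable_1) (auto simp: integrable_on_def)
  then show i: "set_integrable lborel {a..b} f"
    using assms(1) unfolding set_integrable_def
    by (subst (asm) integrable_completion) auto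
  show "(LINT x:{a..b}|lborel. f x) = I"
    using set_borel_integral_eq_integral[OF i] assms(3) by (simp add: integral_unique)
qed

lemma powr_set_integrable:
  fixes a t :: real
  assumes "a > -1" "0 \<le> t"
  shows "set_integrable lborel {0..t} (\<lambda>u. u powr a)"
  using nonneg_has_integral_lborel(1)[OF _ _ has_integral_powr_from_0[OF assms]] by auto

text \<open>The substitution \<open>u = t - s\<close> on \<open>[0, t]\<close>. It moves the singularity of the kernels to the fixed point \<open>0\<close>,
so that continuity in \<open>t\<close> becomes a question of dominated convergence.\<close>

lemma lborel_shift_reflect:
  fixes g :: "real \<Rightarrow> real"
  shows set_integrable_reflect_iff:
      "set_integrable lborel {0..t} (\<lambda>s. g (t - s)) \<longleftrightarrow> set_integrable lborel {0..t} g"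
    and LINT_reflect: "(LINT s:{0..t}|lborel. g (t - s)) = (LINT u:{0..t}|lborel. g u)"
proof -
  have eq: "indicator {0..t} (t + -1 * s) *\<^sub>R g (t + -1 * s) = indicator {0..t} s *\<^sub>R g (t - s)" for s
    by (auto simp: indicator_def)
  show "set_integrable lborel {0..t} (\<lambda>s. g (t - s)) \<longleftrightarrow> set_integrable lborel {0..t} g"
    using lborel_integrable_real_affine_iff[of "-1" "\<lambda>u. indicator {0..t} u *\<^sub>R g u" t]
    unfolding set_integrable_def eq by simp
  show "(LINT s:{0..t}|lborel. g (t - s)) = (LINT u:{0..t}|lborel. g u)"
    using lborel_integral_real_affine[of "-1" "\<lambda>u. indicator {0..t} u *\<^sub>R g u" t]
    unfolding set_lebesgue_integral_def eq by simp
qed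

lemma rl_integral_reflect:
  "rl_integral p f t = 1 / Gamma p * (LINT u:{0..t}|lborel. u powr (p - 1) * f (t - u))"
  using LINT_reflect[of t "\<lambda>u. u powr (p - 1) * f (t - u)"] by (simp add: rl_integral_def)

lemma set_integrable_mult_bounded:
  fixes k f :: "real \<Rightarrow> real"
  assumes "set_integrable lborel A k" and "set_borel_measurable lborel A f"
    and "\<And>x. x \<in> A \<Longrightarrow> \<bar>f x\<bar> \<le> B"
  shows "set_integrable lborel A (\<lambda>x. k x * f x)"
  unfolding set_integrable_def
proof (rule Bochner_Integration.integrable_bound)
  show "integrable lborel (\<lambda>x. B * (indicator A x *\<^sub>R k x))"
    using assms(1) by (simp add: set_integrable_def)
  have [measurable]: "(\<lambda>x. indicator A x *\<^sub>R k x) \<in> borel_measurable lborel"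
    "(\<lambda>x. indicator A x *\<^sub>R f x) \<in> borel_measurable lborel"
    using assms(1,2) by (auto simp: set_integrable_def set_borel_measurable_def)
  have "(\<lambda>x. (indicator A x *\<^sub>R k x) * (indicator A x *\<^sub>R f x)) \<in> borel_measurable lborel"
    by measurable
  also have "(\<lambda>x. (indicator A x *\<^sub>R k x) * (indicator A x *\<^sub>R f x)) = (\<lambda>x. indicator A x *\<^sub>R (k x * f x))"
    by (auto simp: indicator_def)
  finally show "(\<lambda>x. indicator A x *\<^sub>R (k x * f x)) \<in> borel_measurable lborel" .
  show "AE x in lborel. norm (indicator A x *\<^sub>R (k x * f x)) \<le> norm (B * (indicator A x *\<^sub>R k x))"
  proof (rule AE_I2)
    fix x
    have "\<bar>k x\<bar> * \<bar>f x\<bar> \<le> \<bar>B\<bar> * \<bar>k x\<bar>" if "x \<in> A"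
      using mult_right_mono[OF order_trans[OF assms(3)[OF that] abs_ge_self], of "\<bar>k x\<bar>"]
      by (simp add: mult.commute)
    then show "norm (indicator A x *\<^sub>R (k x * f x)) \<le> norm (B * (indicator A x *\<^sub>R k x))"
      by (auto simp: indicator_def abs_mult)
  qed
qed

lemma continuous_on_interval_measurable_bounded:
  fixes f :: "real \<Rightarrow> real"
  assumes "continuous_on {0..T} f"
  shows "set_borel_measurable lborel {0..T} f" "\<exists>B. \<forall>s\<in>{0..T}. \<bar>f s\<bar> \<le> B"
proof -
  show "set_borel_measurable lborel {0..T} f"
    using assms set_measurable_continuous_on[of "{0..T}" f]
    by (simp add: set_borel_measurable_def)
  show "\<exists>B. \<forall>s\<in>{0..T}. \<bar>f s\<bar> \<le> B"
    using compact_imp_bounded[OF compact_continuous_image[OF assms compact_Icc]]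
    by (auto simp: bounded_iff)
qed

lemma rl_set_integrable:
  fixes f :: "real \<Rightarrow> real"
  assumes "p > 0" "0 \<le> t" "continuous_on {0..t} f"
  shows "set_integrable lborel {0..t} (\<lambda>s. (t - s) powr (p - 1) * f s)"
proof -
  obtain B where "\<forall>s\<in>{0..t}. \<bar>f s\<bar> \<le> B"
    using continuous_on_interval_measurable_bounded(2)[OF assms(3)] by blast
  moreover have "set_integrable lborel {0..t} (\<lambda>s. (t - s) powr (p - 1))"
    using set_integrable_reflect_iff[of t "\<lambda>u. u powr (p - 1)"] powr_set_integrable[of "p - 1" t] assms
    by simp
  ultimately show ?thesis
    using set_integrable_mult_bounded continuous_on_interval_measurable_bounded(1)[OF assms(3)]
    by blast
qed

text \<open>Both the Riemann--Liouville integral and the Marchaud form have a moving upper limit and an integrand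
that is singular at \<open>u = 0\<close>; the singularity is absorbed by a dominating function \<open>D\<close> that does not
depend on \<open>t\<close>.\<close>

lemma continuous_on_LINT_upto:
  fixes F :: "real \<Rightarrow> real \<Rightarrow> real"
  assumes meas: "\<And>t. t \<in> {0..T} \<Longrightarrow> F t \<in> borel_measurable borel"
    and cont: "\<And>u. u \<in> {0<..T} \<Longrightarrow> continuous_on {0..T} (\<lambda>t. F t u)"
    and bound: "\<And>t u. 0 < u \<Longrightarrow> u \<le> t \<Longrightarrow> t \<le> T \<Longrightarrow> \<bar>F t u\<bar> \<le> D u"
    and D: "set_integrable lborel {0..T} D"
  shows "continuous_on {0..T} (\<lambda>t. LINT u:{0..t}|lborel. F t u)"
proof (rule continuous_on_sequentiallyI)
  fix x :: "nat \<Rightarrow> real" and a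
  assume x: "\<forall>n. x n \<in> {0..T}" "a \<in> {0..T}" "x \<longlonglongrightarrow> a"
  have D0: "0 \<le> D u" if "0 < u" "u \<le> T" for u
    using bound[of u u] that by auto
  show "(\<lambda>n. LINT u:{0..x n}|lborel. F (x n) u) \<longlonglongrightarrow> (LINT u:{0..a}|lborel. F a u)"
    unfolding set_lebesgue_integral_def
  proof (rule integral_dominated_convergence)
    show "(\<lambda>u. indicator {0..a} u *\<^sub>R F a u) \<in> borel_measurable lborel"
      using meas[OF x(2)] by measurable
    show "(\<lambda>u. indicator {0..x n} u *\<^sub>R F (x n) u) \<in> borel_measurable lborel" for n
      using meas[OF x(1)[rule_format]] by measurable
    show "integrable lborel (\<lambda>u. indicator {0..T} u *\<^sub>R D u)"
      using D by (simp add: set_integrable_def)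
    show "AE u in lborel. norm (indicator {0..x n} u *\<^sub>R F (x n) u) \<le> indicator {0..T} u *\<^sub>R D u" for n
      using AE_lborel_singleton[of 0]
    proof eventually_elim
      case (elim u)
      then show ?case
        using x(1)[rule_format, of n] D0[of u] bound[of u "x n"] by (auto simp: indicator_def)
    qed
    show "AE u in lborel. (\<lambda>n. indicator {0..x n} u *\<^sub>R F (x n) u) \<longlonglongrightarrow> indicator {0..a} u *\<^sub>R F a u"
      using AE_lborel_singleton[of 0] AE_lborel_singleton[of a]
    proof eventually_elim
      case (elim u)
      consider "u < 0" | "0 < u" "u < a" | "a < u" using elim by linarith
      then show ?case
      proof cases
        case 2
        then have lim: "(\<lambda>n. F (x n) u) \<longlonglongrightarrow> F a u"
          using cont[of u] x by (auto simp: continuous_on_sequentially o_def)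
        have "\<forall>\<^sub>F n in sequentially. u < x n"
          using 2 x(3) order_tendstoD(1) by blast
        then have "\<forall>\<^sub>F n in sequentially. F (x n) u = indicator {0..x n} u *\<^sub>R F (x n) u"
          by eventually_elim (use 2 in auto)
        then show ?thesis
          using 2 lim by (auto intro: Lim_transform_eventually)
      next
        case 3
        have "\<forall>\<^sub>F n in sequentially. x n < u"
          using 3 x(3) order_tendstoD(2) by blast
        then have "\<forall>\<^sub>F n in sequentially. 0 = indicator {0..x n} u *\<^sub>R F (x n) u"
          by eventually_elim auto
        then show ?thesis
          using 3 by (auto intro: tendsto_eventually eventually_mono)
      qed auto
    qed
  qed
qed

lemma rl_integral_cong:
  assumes "\<And>s. s \<in> {0..t} \<Longrightarrow> f s = g s"
  shows "rl_integral p f t = rl_integral p g t"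
  unfolding rl_integral_def using assms by (auto intro!: set_lebesgue_integral_cong)

lemma rl_integral_cmult: "rl_integral p (\<lambda>s. c * g s) t = c * rl_integral p g t"
  by (simp add: rl_integral_def mult.left_commute)

text \<open>A function that is continuous on \<open>[0, T]\<close> may be replaced by its extension that is constant outside, which
is continuous, hence Borel measurable, on the whole line.\<close>

lemma ext_cont_real:
  fixes f :: "real \<Rightarrow> real"
  assumes "continuous_on {0..T} f"
  shows "continuous_on UNIV (ext_cont f 0 T)" "\<And>s. s \<in> {0..T} \<Longrightarrow> ext_cont f 0 T s = f s"
  using assms continuous_on_ext_cont[of 0 T f UNIV] ext_cont_cancel_cbox[of _ 0 T f] by auto

lemma continuous_on_rl_integral:
  assumes "p > 0" and f: "continuous_on {0..T} f"
  shows "continuous_on {0..T} (rl_integral p f)"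
proof (cases "0 \<le> T")
  case True
  define g where "g = ext_cont f 0 T"
  have g: "continuous_on UNIV g" and gf: "\<And>s. s \<in> {0..T} \<Longrightarrow> g s = f s"
    using ext_cont_real[OF f] by (auto simp: g_def)
  obtain B where B: "\<forall>s\<in>{0..T}. \<bar>g s\<bar> \<le> B"
    using continuous_on_interval_measurable_bounded(2) g continuous_on_subset by blast
  have [measurable]: "g \<in> borel_measurable borel"
    using g by (rule borel_measurable_continuous_onI)
  have "continuous_on {0..T} (\<lambda>t. LINT u:{0..t}|lborel. u powr (p - 1) * g (t - u))"
  proof (rule continuous_on_LINT_upto[where D = "\<lambda>u. B * u powr (p - 1)"])
    show "continuous_on {0..T} (\<lambda>t. u powr (p - 1) * g (t - u))" for u
      by (intro continuous_intros continuous_on_compose2[OF g]) auto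
    show "set_integrable lborel {0..T} (\<lambda>u. B * u powr (p - 1))"
      using powr_set_integrable[of "p - 1" T] True assms(1) by simp
    show "\<bar>u powr (p - 1) * g (t - u)\<bar> \<le> B * u powr (p - 1)" if "0 < u" "u \<le> t" "t \<le> T" for t u
    proof -
      have "\<bar>g (t - u)\<bar> \<le> B" using B that by auto
      then show ?thesis
        by (simp add: abs_mult mult.commute mult_right_mono)
    qed
  qed auto
  then have "continuous_on {0..T} (rl_integral p g)"
    unfolding rl_integral_reflect[abs_def] by (intro continuous_intros)
  moreover have "rl_integral p g t = rl_integral p f t" if "t \<in> {0..T}" for t
    using that gf by (intro rl_integral_cong) auto
  ultimately show ?thesis using continuous_on_cong[OF refl, of "{0..T}"] by blast
qed auto

text \<open>The substitution \<open>s = r + (t - r) v\<close> reduces the composition of two power kernels to Euler's Beta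
integral.\<close>

lemma Beta_kernel:
  fixes p q r t :: real
  assumes "p > 0" "q > 0" "r < t"
  shows "(LINT s:{r..t}|lborel. (t - s) powr (p - 1) * (s - r) powr (q - 1)) =
           Beta q p * (t - r) powr (p + q - 1)"
proof -
  let ?f = "\<lambda>s. (t - s) powr (p - 1) * (s - r) powr (q - 1)"
  let ?b = "\<lambda>v. v powr (q - 1) * (1 - v) powr (p - 1)"
  have b: "(LINT v:{0..1}|lborel. ?b v) = Beta q p"
    using nonneg_has_integral_lborel(2)[OF _ _ has_integral_Beta_real[OF assms(2,1)]] by auto
  have eq: "indicator {r..t} (r + (t - r) * v) *\<^sub>R ?f (r + (t - r) * v) =
        (t - r) powr (p + q - 2) * (indicator {0..1} v *\<^sub>R ?b v)" for v
  proof -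
    have ind: "indicator {r..t} (r + (t - r) * v) = (indicator {0..1} v :: real)"
    proof -
      have "r + (t - r) * v \<le> t \<longleftrightarrow> v \<le> 1"
        using assms(3) mult_le_cancel_left_pos[of "t - r" v 1] by (simp add: algebra_simps)
      then show ?thesis
        using assms(3) by (auto simp: indicator_def zero_le_mult_iff)
    qed
    have a: "t - (r + (t - r) * v) = (t - r) * (1 - v)" by (simp add: algebra_simps)
    show ?thesis
    proof (cases "v \<in> {0..1}")
      case True
      have "(t - r) powr (p + q - 2) = (t - r) powr (p - 1) * (t - r) powr (q - 1)"
        by (simp add: powr_add[symmetric])
      then show ?thesis
        unfolding ind a using True assms(3) by (simp add: powr_mult)
    qed (simp only: ind, simp)
  qed
  have "(LINT s:{r..t}|lborel. ?f s) = \<bar>t - r\<bar> * ((t - r) powr (p + q - 2) * Beta q p)"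
    unfolding b[symmetric] set_lebesgue_integral_def
    using lborel_integral_real_affine[of "t - r" "\<lambda>s. indicator {r..t} s *\<^sub>R ?f s" r] assms(3)
    unfolding eq by simp
  also have "\<dots> = Beta q p * (t - r) powr (p + q - 1)"
    using assms(3) powr_add[of "t - r" "p + q - 2" 1] by simp
  finally show "(LINT s:{r..t}|lborel. ?f s) = Beta q p * (t - r) powr (p + q - 1)" .
qed

text \<open>Fubini's theorem on the triangle \<open>0 \<le> r \<le> s \<le> t\<close>: the inner integral over \<open>s\<close> is \<open>Beta_kernel\<close>, and the
Gamma factors cancel because \<open>B(q, p) = \<Gamma>(q) \<Gamma>(p) / \<Gamma>(p + q)\<close>.\<close>

lemma rl_integral_semigroup:
  assumes p: "p > 0" and q: "q > 0" and t: "0 \<le> t" and f: "continuous_on {0..t} f"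
  shows "rl_integral p (rl_integral q f) t = rl_integral (p + q) f t"
proof -
  \<comment> \<open>cutting off outside \<open>[0, t]\<close> makes the integrand on the plane Borel measurable\<close>
  define g where "g s = indicator {0..t} s * f s" for s
  have g_meas[measurable]: "g \<in> borel_measurable borel"
    using continuous_on_interval_measurable_bounded(1)[OF f]
    by (simp add: set_borel_measurable_def g_def[abs_def])
  obtain B where B: "\<forall>s\<in>{0..t}. \<bar>f s\<bar> \<le> B"
    using continuous_on_interval_measurable_bounded(2)[OF f] by blast
  define F where "F s r = indicator {0..t} s * indicator {0..s} r *
      ((t - s) powr (p - 1) * (s - r) powr (q - 1) * g r)" for s r :: real
  have F_meas: "(\<lambda>(s, r). F s r) \<in> borel_measurable (lborel \<Otimes>\<^sub>M lborel)"
  proof -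
    have "(\<lambda>(s, r). F s r) = (\<lambda>x. (if 0 \<le> fst x \<and> fst x \<le> t \<and> 0 \<le> snd x \<and> snd x \<le> fst x then
       (t - fst x) powr (p - 1) * (fst x - snd x) powr (q - 1) * g (snd x) else 0))"
      by (auto simp: F_def indicator_def fun_eq_iff)
    also have "\<dots> \<in> borel_measurable (lborel \<Otimes>\<^sub>M lborel)" by measurable
    finally show ?thesis .
  qed
  have F_eq: "F s r = indicator {0..t} s * (t - s) powr (p - 1) * (indicator {0..s} r *\<^sub>R ((s - r) powr (q - 1) * f r))" for s r
    by (auto simp: F_def g_def indicator_def)
  have f': "continuous_on {0..s} f" if "s \<in> {0..t}" for s
    using f by (rule continuous_on_subset) (use that in auto)
  have fibre: "integrable lborel (F s)" for s
  proof (cases "s \<in> {0..t}")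
    case True
    then have "integrable lborel (\<lambda>r. indicator {0..s} r *\<^sub>R ((s - r) powr (q - 1) * f r))"
      using rl_set_integrable[OF q _ f'[OF True]] by (simp add: set_integrable_def)
    then show ?thesis unfolding F_eq by (rule integrable_mult_right)
  next
    case False
    then have "F s = (\<lambda>r. 0)" by (auto simp: F_def)
    then show ?thesis by simp
  qed
  have int: "integrable (lborel \<Otimes>\<^sub>M lborel) (\<lambda>(s, r). F s r)"
  proof (rule lborel_pair.Fubini_integrable[OF F_meas])
    have "integrable lborel (\<lambda>s. indicator {0..t} s *\<^sub>R ((t - s) powr (p - 1) * (Gamma q * rl_integral q (\<lambda>s. \<bar>f s\<bar>) s)))"
    proof -
      have "continuous_on {0..t} (\<lambda>s. Gamma q * rl_integral q (\<lambda>s. \<bar>f s\<bar>) s)"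
        using f by (intro continuous_intros continuous_on_rl_integral[OF q]) auto
      from rl_set_integrable[OF p t this] show ?thesis by (simp add: set_integrable_def)
    qed
    moreover have "(LINT r|lborel. norm (F s r)) =
        indicator {0..t} s *\<^sub>R ((t - s) powr (p - 1) * (Gamma q * rl_integral q (\<lambda>s. \<bar>f s\<bar>) s))" for s
    proof -
      have "(LINT r|lborel. norm (F s r)) = (LINT r|lborel. indicator {0..t} s * (t - s) powr (p - 1) *
           (indicator {0..s} r *\<^sub>R ((s - r) powr (q - 1) * \<bar>f r\<bar>)))"
        by (intro Bochner_Integration.integral_cong) (auto simp: F_eq abs_mult)
      also have "\<dots> = indicator {0..t} s * (t - s) powr (p - 1) *
          (LINT r:{0..s}|lborel. (s - r) powr (q - 1) * \<bar>f r\<bar>)"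
        unfolding set_lebesgue_integral_def by (rule integral_mult_right_zero)
      finally show ?thesis
        using Gamma_real_pos[OF q] by (simp add: rl_integral_def)
    qed
    ultimately show "integrable lborel (\<lambda>s. LINT r|lborel. norm ((\<lambda>(s, r). F s r) (s, r)))" by simp
    show "AE s in lborel. integrable lborel (\<lambda>r. (\<lambda>(s, r). F s r) (s, r))" using fibre by simp
  qed
  have inner: "(LINT s|lborel. F s r) = indicator {0..t} r *\<^sub>R ((Beta q p * (t - r) powr (p + q - 1)) * f r)"
    if "r \<noteq> t" for r
  proof (cases "r \<in> {0..t}")
    case True
    with that have "r < t" by auto
    have "(LINT s|lborel. F s r) = (LINT s|lborel. (indicator {r..t} s *\<^sub>R ((t - s) powr (p - 1) * (s - r) powr (q - 1))) * f r)"
      using True by (intro Bochner_Integration.integral_cong) (auto simp: F_def g_def indicator_def)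
    also have "\<dots> = (LINT s:{r..t}|lborel. (t - s) powr (p - 1) * (s - r) powr (q - 1)) * f r"
      unfolding set_lebesgue_integral_def by (rule integral_mult_left_zero)
    finally show ?thesis using Beta_kernel[OF p q \<open>r < t\<close>] True by simp
  qed (auto simp: F_def g_def indicator_def)
  have Gpq: "0 < Gamma (p + q)" using p q by (intro Gamma_real_pos) simp
  have "Gamma p * Gamma q * rl_integral p (rl_integral q f) t = (LINT s|lborel. LINT r|lborel. F s r)"
  proof -
    have "(LINT r|lborel. F s r) = Gamma q * (indicator {0..t} s *\<^sub>R ((t - s) powr (p - 1) * rl_integral q f s))" for s
    proof -
      have "(LINT r|lborel. F s r) = indicator {0..t} s * (t - s) powr (p - 1) *
          (LINT r:{0..s}|lborel. (s - r) powr (q - 1) * f r)"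
        unfolding F_eq set_lebesgue_integral_def by (rule integral_mult_right_zero)
      then show ?thesis using Gamma_real_pos[OF q] by (simp add: rl_integral_def)
    qed
    then show ?thesis
      using Gamma_real_pos[OF p] by (simp add: rl_integral_def[of p] set_lebesgue_integral_def)
  qed
  also have "\<dots> = (LINT r|lborel. LINT s|lborel. F s r)"
    using lborel_pair.Fubini_integral[of F] int by simp
  also have "\<dots> = (LINT r|lborel. Beta q p * (indicator {0..t} r *\<^sub>R ((t - r) powr (p + q - 1) * f r)))"
  proof (rule integral_cong_AE)
    show "(\<lambda>r. LINT s|lborel. F s r) \<in> borel_measurable lborel"
      using measurable_pair_swap[OF F_meas]
      by (intro lborel.borel_measurable_lebesgue_integral) (simp add: case_prod_unfold)
    have "(\<lambda>r. Beta q p * ((t - r) powr (p + q - 1) * g r)) \<in> borel_measurable lborel" by measurable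
    then show "(\<lambda>r. Beta q p * (indicator {0..t} r *\<^sub>R ((t - r) powr (p + q - 1) * f r))) \<in> borel_measurable lborel"
      by (simp add: g_def mult.left_commute)
    show "AE r in lborel. (LINT s|lborel. F s r) = Beta q p * (indicator {0..t} r *\<^sub>R ((t - r) powr (p + q - 1) * f r))"
      using AE_lborel_singleton[of t] by eventually_elim (simp add: inner)
  qed
  also have "\<dots> = Beta q p * (Gamma (p + q) * rl_integral (p + q) f t)"
    using Gpq by (simp add: rl_integral_def set_lebesgue_integral_def)
  also have "\<dots> = Gamma p * Gamma q * rl_integral (p + q) f t"
    using Gpq by (simp add: Beta_def add.commute)
  finally show ?thesis using Gamma_real_pos[OF p] Gamma_real_pos[OF q] by simp
qed

lemma rl_integral_1:
  assumes "continuous_on {0..t} f"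
  shows "rl_integral 1 f t = integral {0..t} f"
proof -
  have i: "set_integrable lborel {0..t} f"
    using assms by (rule borel_integrable_atLeastAtMost')
  then have [measurable]: "(\<lambda>s. indicator {0..t} s *\<^sub>R f s) \<in> borel_measurable lborel"
    unfolding set_integrable_def by auto
  have "(LINT s:{0..t}|lborel. (t - s) powr (1 - 1) * f s) =
      (LINT s|lborel. (t - s) powr (1 - 1) * (indicator {0..t} s *\<^sub>R f s))"
    by (simp add: set_lebesgue_integral_def mult.left_commute)
  also have "\<dots> = (LINT s:{0..t}|lborel. f s)"
    unfolding set_lebesgue_integral_def
  proof (rule integral_cong_AE)
    show "AE s in lborel. (t - s) powr (1 - 1) * (indicator {0..t} s *\<^sub>R f s) = indicator {0..t} s *\<^sub>R f s"
      using AE_lborel_singleton[of t] by eventually_elim auto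
  qed measurable
  finally have "(LINT s:{0..t}|lborel. (t - s) powr (1 - 1) * f s) = (LINT s:{0..t}|lborel. f s)" .
  then show ?thesis
    using set_borel_integral_eq_integral(2)[OF i] by (simp add: rl_integral_def)
qed

text \<open>\<open>J\<^sup>1\<close> is the ordinary primitive, which determines a continuous function by differentiation.\<close>

lemma rl_integral_1_inj:
  assumes "continuous_on {0..T} f" "continuous_on {0..T} g"
    and "\<And>t. t \<in> {0..T} \<Longrightarrow> rl_integral 1 f t = rl_integral 1 g t" and t: "t \<in> {0..T}" and "T > 0"
  shows "f t = g t"
proof -
  have d: "((\<lambda>x. integral {0..x} h) has_vector_derivative h t) (at t within {0..T})"
    if "continuous_on {0..T} h" for h :: "real \<Rightarrow> real"
    using integral_has_vector_derivative[OF that t] .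
  have eq: "integral {0..x} f = integral {0..x} g" if "x \<in> {0..T}" for x
  proof -
    have "continuous_on {0..x} f" "continuous_on {0..x} g"
      using assms(1,2) that by (auto elim: continuous_on_subset)
    then show ?thesis using assms(3)[OF that] by (simp add: rl_integral_1)
  qed
  have "((\<lambda>x. integral {0..x} f) has_vector_derivative g t) (at t within {0..T})"
    using has_vector_derivative_transform[OF t eq d[OF assms(2)]] by simp
  moreover have "at t within {0..T} \<noteq> bot"
    using t \<open>T > 0\<close> by (simp add: trivial_limit_within islimpt_Icc)
  ultimately show ?thesis
    using vector_derivative_unique_within d[OF assms(1)] by blast
qed

section \<open>Fractional integration and differentiation in Marchaud form\<close>

text \<open>This is \<open>\<Gamma>(1 + \<alpha>)\<close> times the fractional integral of order \<open>\<alpha>\<close> of \<open>f\<close> when \<open>\<alpha> \<ge> 0\<close>, and \<open>\<Gamma>(1 + \<alpha>)\<close> times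
the fractional derivative of order \<open>- \<alpha>\<close> in Marchaud's form when \<open>\<alpha> < 0\<close>. The increment \<open>f t - f (t - u)\<close>
tames the singularity \<open>u powr (\<alpha> - 1)\<close>.\<close>

definition marchaud :: "real \<Rightarrow> (real \<Rightarrow> real) \<Rightarrow> real \<Rightarrow> real" where
  "marchaud \<alpha> f t =
     t powr \<alpha> * f t - \<alpha> * (LINT u:{0..t}|lborel. u powr (\<alpha> - 1) * (f t - f (t - u)))"

lemma tendsto_powr_dist_0:
  fixes s b c :: real
  assumes "0 < b"
  shows "((\<lambda>t. c * \<bar>t - s\<bar> powr b) \<longlongrightarrow> 0) (at s within A)"
proof -
  have "((\<lambda>t. \<bar>t - s\<bar>) \<longlongrightarrow> \<bar>s - s\<bar>) (at s within A)" by (intro tendsto_intros)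
  then have "((\<lambda>t. \<bar>t - s\<bar> powr b) \<longlongrightarrow> 0) (at s within A)"
    using assms by (intro tendsto_zero_powrI[where b = b]) auto
  then show ?thesis by (rule tendsto_mult_right_zero)
qed

text \<open>The Hoelder condition is imposed on the whole real line, so that \<open>t - u\<close> need never be confined to an
interval; paths given on \<open>[0, T]\<close> are extended by constants before this locale is used.\<close>

locale holder_path =
  fixes f :: "real \<Rightarrow> real" and \<alpha> \<eta> C :: real
  assumes alpha: "-1 < \<alpha>" and eta: "0 < \<eta>" and alpha_eta: "0 < \<alpha> + \<eta>"
    and holder: "\<And>s t. \<bar>f t - f s\<bar> \<le> C * \<bar>t - s\<bar> powr \<eta>"
    and start: "f 0 = 0"
begin

lemma C_nonneg: "0 \<le> C"
  using order_trans[OF abs_ge_zero holder[of 1 0]] by simp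

lemma continuous: "continuous_on A f"
proof -
  have "isCont f s" for s
  proof -
    have "((\<lambda>t. C * \<bar>t - s\<bar> powr \<eta>) \<longlongrightarrow> 0) (at s)"
      using eta by (rule tendsto_powr_dist_0)
    moreover have "\<forall>\<^sub>F t in at s. norm (f t - f s) \<le> C * \<bar>t - s\<bar> powr \<eta>"
      unfolding real_norm_def by (intro always_eventually allI holder)
    ultimately have "((\<lambda>t. f t - f s) \<longlongrightarrow> 0) (at s)"
      by (rule Lim_null_comparison[rotated])
    then show ?thesis by (simp add: isCont_def LIM_zero_iff)
  qed
  then show ?thesis by (simp add: continuous_at_imp_continuous_on)
qed

lemma measurable_f[measurable]: "f \<in> borel_measurable borel"
  using continuous by (rule borel_measurable_continuous_onI)

lemma kernel_bound:
  assumes "0 \<le> u"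
  shows "\<bar>u powr (\<alpha> - 1) * (f t - f (t - u))\<bar> \<le> C * u powr (\<alpha> - 1 + \<eta>)"
  using mult_left_mono[OF holder[of t "t - u"], of "u powr (\<alpha> - 1)"] assms
  by (simp add: abs_mult powr_add mult_ac)

lemma dominating_integrable:
  assumes "0 \<le> t"
  shows "set_integrable lborel {0..t} (\<lambda>u. C * u powr (\<alpha> - 1 + \<eta>))"
  using alpha_eta assms by (intro set_integrable_mult_right powr_set_integrable) auto

lemma kernel_integrable:
  assumes "0 \<le> t"
  shows "set_integrable lborel {0..t} (\<lambda>u. u powr (\<alpha> - 1) * (f t - f (t - u)))"
  using dominating_integrable[OF assms]
proof (rule set_integrable_bound)
  show "set_borel_measurable lborel {0..t} (\<lambda>u. u powr (\<alpha> - 1) * (f t - f (t - u)))"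
    unfolding set_borel_measurable_def by measurable
  show "AE u \<in> {0..t} in lborel. norm (u powr (\<alpha> - 1) * (f t - f (t - u)))
      \<le> norm (C * u powr (\<alpha> - 1 + \<eta>))"
    using kernel_bound by (intro AE_I2) (auto intro: order_trans[OF _ abs_ge_self])
qed

text \<open>For \<open>\<alpha> < 0\<close> the factor \<open>t powr \<alpha>\<close> blows up at \<open>0\<close>, but \<open>f t = O(t powr \<eta>)\<close> compensates. The limit \<open>0\<close> agrees
with the value there because \<open>f 0 = 0\<close>.\<close>

lemma continuous_powr_mult: "continuous_on {0..T} (\<lambda>t. t powr \<alpha> * f t)"
  unfolding continuous_on_eq_continuous_within
proof
  fix t assume t: "t \<in> {0..T}"
  show "continuous (at t within {0..T}) (\<lambda>t. t powr \<alpha> * f t)"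
  proof (cases "t = 0")
    case True
    have "\<bar>s powr \<alpha> * f s\<bar> \<le> C * \<bar>s\<bar> powr (\<alpha> + \<eta>)" if "s \<in> {0..T}" for s
      using mult_left_mono[OF holder[of s 0], of "s powr \<alpha>"] that start
      by (simp add: abs_mult powr_add mult_ac)
    then have "\<forall>\<^sub>F s in at 0 within {0..T}. norm (s powr \<alpha> * f s) \<le> C * \<bar>s\<bar> powr (\<alpha> + \<eta>)"
      by (simp add: eventually_at_filter)
    moreover have "((\<lambda>s. C * \<bar>s\<bar> powr (\<alpha> + \<eta>)) \<longlongrightarrow> 0) (at 0 within {0..T})"
      using tendsto_powr_dist_0[OF alpha_eta, of C 0] by simp
    ultimately have "((\<lambda>s. s powr \<alpha> * f s) \<longlongrightarrow> 0) (at 0 within {0..T})"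
      by (rule Lim_null_comparison)
    then show ?thesis by (simp add: continuous_within True)
  next
    case False
    have "isCont f t" using continuous[of UNIV] by (simp add: continuous_on_eq_continuous_at)
    then have "isCont (\<lambda>t. t powr \<alpha> * f t) t"
      using False by (intro continuous_intros) auto
    then show ?thesis by (rule continuous_at_imp_continuous_at_within)
  qed
qed

lemma continuous_marchaud: "continuous_on {0..T} (marchaud \<alpha> f)"
proof (cases "0 \<le> T")
  case True
  have "continuous_on {0..T} (\<lambda>t. LINT u:{0..t}|lborel. u powr (\<alpha> - 1) * (f t - f (t - u)))"
  proof (rule continuous_on_LINT_upto[where D = "\<lambda>u. C * u powr (\<alpha> - 1 + \<eta>)"])
    show "continuous_on {0..T} (\<lambda>t. u powr (\<alpha> - 1) * (f t - f (t - u)))" for u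
      by (intro continuous_intros continuous continuous_on_compose2[OF continuous[of UNIV]]) auto
  qed (use kernel_bound dominating_integrable True in auto)
  then show ?thesis
    unfolding marchaud_def[abs_def] by (intro continuous_intros continuous_powr_mult)
qed auto

lemma antiderivative:
  obtains W where "\<And>x. x \<in> {0..t} \<Longrightarrow> (W has_real_derivative f x) (at x)" "W 0 = (0::real)"
proof -
  \<comment> \<open>the larger interval makes all points of \<open>[0, t]\<close> interior, so that the derivatives are two-sided\<close>
  obtain g where g: "\<And>x. x \<in> {-1..t+1} \<Longrightarrow> (g has_vector_derivative f x) (at x within {-1..t+1})"
    using antiderivative_continuous[OF continuous] by metis
  have "((\<lambda>x. g x - g 0) has_real_derivative f x) (at x)" if "x \<in> {0..t}" for x
  proof -
    have "(g has_vector_derivative f x) (at x)"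
      using g[of x] that at_within_interior[of x "{-1..t+1}"] by simp
    then show ?thesis
      by (auto simp: has_real_derivative_iff_has_vector_derivative intro!: derivative_eq_intros)
  qed
  then show thesis using that[of "\<lambda>x. g x - g 0"] by simp
qed

text \<open>Here \<open>W\<close> is the primitive of \<open>f\<close>. The function \<open>u powr \<alpha> * (W u + W (t - u) - W t)\<close> vanishes at both ends of
\<open>[0, t]\<close>: the bracket is \<open>O(u)\<close> at \<open>0\<close> and \<open>\<alpha> > - 1\<close>, and at \<open>u = t\<close> it is \<open>0\<close> because \<open>W 0 = 0\<close>. So the
integral of its derivative is zero, which is the claim.\<close>

lemma second_difference_by_parts:
  assumes t: "0 \<le> t" and W: "\<And>x. x \<in> {0..t} \<Longrightarrow> (W has_real_derivative f x) (at x)" "W 0 = 0"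
  shows "\<alpha> * (LINT u:{0..t}|lborel. u powr (\<alpha> - 1) * (W u + W (t - u) - W t)) =
         (LINT u:{0..t}|lborel. u powr \<alpha> * f (t - u)) - (LINT u:{0..t}|lborel. u powr \<alpha> * f u)"
proof -
  define H where "H u = W u + W (t - u) - W t" for u
  obtain B where B: "\<And>s. s \<in> {0..t} \<Longrightarrow> \<bar>f s\<bar> \<le> B"
    using continuous_on_interval_measurable_bounded(2)[OF continuous] by blast
  have Wc: "continuous_on {0..t} W"
    by (intro continuous_at_imp_continuous_on ballI DERIV_isCont[OF W(1)])
  have W_lip: "\<bar>W x - W y\<bar> \<le> B * \<bar>x - y\<bar>" if "x \<in> {0..t}" "y \<in> {0..t}" for x y
    using field_differentiable_bound[of "{0..t}" W f B x y] W(1) B that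
    by (auto intro: has_field_derivative_at_within)
  have H_bound: "\<bar>H u\<bar> \<le> 2 * B * u" if "u \<in> {0..t}" for u
    using W_lip[of u 0] W_lip[of "t - u" t] W(2) that t unfolding H_def by auto
  have Hc: "continuous_on {0..t} H"
    unfolding H_def[abs_def] by (intro continuous_intros Wc continuous_on_compose2[OF Wc]) auto
  have pow: "set_integrable lborel {0..t} (\<lambda>u. u powr \<alpha>)"
    using powr_set_integrable alpha t by blast
  have i1: "set_integrable lborel {0..t} (\<lambda>u. u powr \<alpha> * f u)"
    by (rule set_integrable_mult_bounded[OF pow _ B]) (auto simp: set_borel_measurable_def)
  have i2: "set_integrable lborel {0..t} (\<lambda>u. u powr \<alpha> * f (t - u))"
    by (rule set_integrable_mult_bounded[OF pow _ B]) (auto simp: set_borel_measurable_def)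
  have i3: "set_integrable lborel {0..t} (\<lambda>u. u powr (\<alpha> - 1) * H u)"
  proof (rule set_integrable_bound)
    show "set_integrable lborel {0..t} (\<lambda>u. 2 * B * u powr \<alpha>)" using pow by simp
    have [measurable]: "(\<lambda>u. indicator {0..t} u *\<^sub>R H u) \<in> borel_measurable lborel"
      using continuous_on_interval_measurable_bounded(1)[OF Hc] by (simp add: set_borel_measurable_def)
    have "(\<lambda>u. u powr (\<alpha> - 1) * (indicator {0..t} u *\<^sub>R H u)) \<in> borel_measurable lborel" by measurable
    then show "set_borel_measurable lborel {0..t} (\<lambda>u. u powr (\<alpha> - 1) * H u)"
      by (simp add: set_borel_measurable_def mult.left_commute)
    have "norm (u powr (\<alpha> - 1) * H u) \<le> norm (2 * B * u powr \<alpha>)" if "u \<in> {0..t}" for u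
    proof (cases "u = 0")
      case False
      then have "norm (u powr (\<alpha> - 1) * H u) \<le> u powr (\<alpha> - 1) * (2 * B * u)"
        using H_bound[OF that] by (simp add: abs_mult mult_left_mono)
      also have "\<dots> = 2 * B * u powr \<alpha>"
        using False that powr_add[of u "\<alpha> - 1" 1] by simp
      finally show ?thesis by simp
    qed simp
    then show "AE u\<in>{0..t} in lborel. norm (u powr (\<alpha> - 1) * H u) \<le> norm (2 * B * u powr \<alpha>)"
      by simp
  qed
  have "((\<lambda>u. \<alpha> * (u powr (\<alpha> - 1) * H u) + (u powr \<alpha> * f u - u powr \<alpha> * f (t - u)))
      has_integral (t powr \<alpha> * H t - 0 powr \<alpha> * H 0)) {0..t}"
  proof (rule fundamental_theorem_of_calculus_interior[OF t])
    show "continuous_on {0..t} (\<lambda>u. u powr \<alpha> * H u)"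
      unfolding continuous_on_eq_continuous_within
    proof
      fix u assume u: "u \<in> {0..t}"
      show "continuous (at u within {0..t}) (\<lambda>u. u powr \<alpha> * H u)"
      proof (cases "u = 0")
        case True
        have "\<bar>s powr \<alpha> * H s\<bar> \<le> 2 * B * \<bar>s\<bar> powr (\<alpha> + 1)" if "s \<in> {0..t}" for s
          using mult_left_mono[OF H_bound[OF that], of "s powr \<alpha>"] that
          by (cases "s = 0") (simp_all add: abs_mult powr_add mult_ac)
        then have "\<forall>\<^sub>F s in at 0 within {0..t}. norm (s powr \<alpha> * H s) \<le> 2 * B * \<bar>s\<bar> powr (\<alpha> + 1)"
          by (simp add: eventually_at_filter)
        moreover have "((\<lambda>s. 2 * B * \<bar>s\<bar> powr (\<alpha> + 1)) \<longlongrightarrow> 0) (at 0 within {0..t})"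
          using tendsto_powr_dist_0[of "\<alpha> + 1" "2 * B" 0] alpha by simp
        ultimately have "((\<lambda>s. s powr \<alpha> * H s) \<longlongrightarrow> 0) (at 0 within {0..t})"
          by (rule Lim_null_comparison)
        then show ?thesis by (simp add: continuous_within True)
      next
        case False
        have "continuous (at u within {0..t}) H"
          using Hc u by (simp add: continuous_on_eq_continuous_within)
        then show ?thesis using False by (intro continuous_intros) auto
      qed
    qed
    fix u assume u: "u \<in> {0<..<t}"
    have "((\<lambda>u. W (t - u)) has_real_derivative f (t - u) * (- 1)) (at u)"
      using u by (intro DERIV_chain2[OF W(1)]) (auto intro!: derivative_eq_intros)
    then have "(H has_real_derivative f u + f (t - u) * (- 1) - 0) (at u)"
      unfolding H_def[abs_def] using u by (intro DERIV_diff DERIV_add W(1) DERIV_const) auto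
    then have "((\<lambda>u. u powr \<alpha> * H u) has_real_derivative
        \<alpha> * u powr (\<alpha> - 1) * H u + u powr \<alpha> * (f u - f (t - u))) (at u)"
      using u by (auto intro!: derivative_eq_intros simp: algebra_simps)
    then show "((\<lambda>u. u powr \<alpha> * H u) has_vector_derivative
        \<alpha> * (u powr (\<alpha> - 1) * H u) + (u powr \<alpha> * f u - u powr \<alpha> * f (t - u))) (at u)"
      by (simp add: has_real_derivative_iff_has_vector_derivative algebra_simps)
  qed
  then have "0 = (LINT u:{0..t}|lborel. \<alpha> * (u powr (\<alpha> - 1) * H u) + (u powr \<alpha> * f u - u powr \<alpha> * f (t - u)))"
    using set_borel_integral_eq_integral(2)[OF set_integral_add(1)[OF
        set_integrable_mult_right[OF i3, of \<alpha>] set_integral_diff(1)[OF i1 i2]]] W(2)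
    by (simp add: integral_unique H_def)
  also have "\<dots> = \<alpha> * (LINT u:{0..t}|lborel. u powr (\<alpha> - 1) * H u) +
     ((LINT u:{0..t}|lborel. u powr \<alpha> * f u) - (LINT u:{0..t}|lborel. u powr \<alpha> * f (t - u)))"
    using i1 i2 i3 by (simp add: set_integral_add(2) set_integral_diff)
  finally show ?thesis unfolding H_def by simp
qed

text \<open>Integrate the Marchaud form over \<open>[0, t]\<close> and exchange the order of integration: for fixed \<open>u\<close> the
integral of \<open>f s - f (s - u)\<close> over \<open>s\<close> in \<open>[u, t]\<close> is minus the second difference
\<open>W u + W (t - u) - W t\<close> of the primitive. Integration by parts then cancels the term \<open>u powr \<alpha> * f u\<close>
and leaves the integral of \<open>u powr \<alpha> * f (t - u)\<close>.\<close>

lemma rl_1_marchaud: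
  assumes t: "0 \<le> t"
  shows "rl_integral 1 (marchaud \<alpha> f) t = Gamma (1 + \<alpha>) * rl_integral (1 + \<alpha>) f t"
proof -
  obtain W where W: "\<And>x. x \<in> {0..t} \<Longrightarrow> (W has_real_derivative f x) (at x)" "W 0 = 0"
    using antiderivative by blast
  define F where "F s u = indicator {0..t} s * indicator {0..s} u * (u powr (\<alpha> - 1) * (f s - f (s - u)))" for s u :: real
  have F_meas: "(\<lambda>(s, u). F s u) \<in> borel_measurable (lborel \<Otimes>\<^sub>M lborel)"
  proof -
    have "(\<lambda>(s, u). F s u) = (\<lambda>x. (if 0 \<le> fst x \<and> fst x \<le> t \<and> 0 \<le> snd x \<and> snd x \<le> fst x then
       snd x powr (\<alpha> - 1) * (f (fst x) - f (fst x - snd x)) else 0))"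
      by (auto simp: F_def indicator_def fun_eq_iff)
    also have "\<dots> \<in> borel_measurable (lborel \<Otimes>\<^sub>M lborel)" by measurable
    finally show ?thesis .
  qed
  let ?K = "\<lambda>s u. u powr (\<alpha> - 1) * (f s - f (s - u))"
  have F_eq: "F s u = indicator {0..t} s * (indicator {0..s} u *\<^sub>R ?K s u)" for s u
    by (simp add: F_def)
  have int: "integrable (lborel \<Otimes>\<^sub>M lborel) (\<lambda>(s, u). F s u)"
  proof (rule lborel_pair.Fubini_integrable[OF F_meas])
    have "continuous_on {0..t} (\<lambda>s. LINT u:{0..s}|lborel. \<bar>?K s u\<bar>)"
    proof (rule continuous_on_LINT_upto[where D = "\<lambda>u. C * u powr (\<alpha> - 1 + \<eta>)"])
      show "continuous_on {0..t} (\<lambda>s. \<bar>?K s u\<bar>)" for u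
        by (intro continuous_intros continuous continuous_on_compose2[OF continuous[of UNIV]]) auto
    qed (use kernel_bound dominating_integrable t in auto)
    then have "set_integrable lborel {0..t} (\<lambda>s. LINT u:{0..s}|lborel. \<bar>?K s u\<bar>)"
      by (rule borel_integrable_atLeastAtMost')
    moreover have "(LINT u|lborel. norm (F s u)) = indicator {0..t} s *\<^sub>R (LINT u:{0..s}|lborel. \<bar>?K s u\<bar>)" for s
      by (simp add: F_eq abs_mult set_lebesgue_integral_def)
    ultimately show "integrable lborel (\<lambda>s. LINT u|lborel. norm ((\<lambda>(s, u). F s u) (s, u)))"
      by (simp add: set_integrable_def)
    have "integrable lborel (F s)" for s
    proof (cases "s \<in> {0..t}")
      case True
      then show ?thesis
        unfolding F_eq using kernel_integrable[of s]
        by (intro integrable_mult_right) (auto simp: set_integrable_def)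
    next
      case False
      then have "F s = (\<lambda>u. 0)" by (auto simp: F_def)
      then show ?thesis by simp
    qed
    then show "AE s in lborel. integrable lborel (\<lambda>u. (\<lambda>(s, u). F s u) (s, u))" by simp
  qed
  have inner: "(LINT s|lborel. F s u) = indicator {0..t} u *\<^sub>R (u powr (\<alpha> - 1) * - (W u + W (t - u) - W t))" for u
  proof (cases "u \<in> {0..t}")
    case True
    have "((\<lambda>s. f s - f (s - u)) has_integral ((W t - W (t - u)) - (W u - W (u - u)))) {u..t}"
    proof (rule fundamental_theorem_of_calculus)
      fix s assume s: "s \<in> {u..t}"
      have "((\<lambda>s. W (s - u)) has_real_derivative f (s - u) * 1) (at s)"
        using s True by (intro DERIV_chain2[OF W(1)]) (auto intro!: derivative_eq_intros)
      then have "((\<lambda>s. W s - W (s - u)) has_real_derivative f s - f (s - u) * 1) (at s)"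
        using s True by (intro DERIV_diff W(1)) auto
      then show "((\<lambda>s. W s - W (s - u)) has_vector_derivative f s - f (s - u)) (at s within {u..t})"
        by (simp add: has_real_derivative_iff_has_vector_derivative has_vector_derivative_at_within)
    qed (use True in auto)
    moreover have "set_integrable lborel {u..t} (\<lambda>s. f s - f (s - u))"
      by (intro borel_integrable_atLeastAtMost' continuous_intros continuous
          continuous_on_compose2[OF continuous[of UNIV]]) auto
    ultimately have i: "(LINT s:{u..t}|lborel. f s - f (s - u)) = - (W u + W (t - u) - W t)"
      using W(2) by (simp add: set_borel_integral_eq_integral(2) integral_unique)
    have "(LINT s|lborel. F s u) = (LINT s|lborel. u powr (\<alpha> - 1) * (indicator {u..t} s *\<^sub>R (f s - f (s - u))))"
      using True by (intro Bochner_Integration.integral_cong) (auto simp: F_def indicator_def)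
    also have "\<dots> = u powr (\<alpha> - 1) * (LINT s:{u..t}|lborel. f s - f (s - u))"
      unfolding set_lebesgue_integral_def by (rule integral_mult_right_zero)
    finally show ?thesis using i True by simp
  next
    case False
    then have "F s u = 0" for s by (auto simp: F_def indicator_def)
    then show ?thesis using False by simp
  qed
  have pow: "set_integrable lborel {0..t} (\<lambda>s. s powr \<alpha> * f s)"
    using continuous_powr_mult by (rule borel_integrable_atLeastAtMost')
  have dbl: "set_integrable lborel {0..t} (\<lambda>s. LINT u:{0..s}|lborel. ?K s u)"
  proof -
    have "integrable lborel (\<lambda>s. LINT u|lborel. F s u)"
      using lborel_pair.integrable_fst[OF int] by simp
    then show ?thesis by (simp add: set_integrable_def F_eq set_lebesgue_integral_def)
  qed
  have "(LINT s:{0..t}|lborel. LINT u:{0..s}|lborel. ?K s u) = (LINT s|lborel. LINT u|lborel. F s u)"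
    by (simp add: F_eq set_lebesgue_integral_def)
  also have "\<dots> = (LINT u|lborel. LINT s|lborel. F s u)"
    using lborel_pair.Fubini_integral[of F] int by simp
  also have "\<dots> = - (LINT u:{0..t}|lborel. u powr (\<alpha> - 1) * (W u + W (t - u) - W t))"
    unfolding inner
    by (simp only: mult_minus_right scaleR_minus_right Bochner_Integration.integral_minus set_lebesgue_integral_def)
  finally have double: "\<alpha> * (LINT s:{0..t}|lborel. LINT u:{0..s}|lborel. ?K s u) =
      (LINT u:{0..t}|lborel. u powr \<alpha> * f u) - (LINT u:{0..t}|lborel. u powr \<alpha> * f (t - u))"
    using second_difference_by_parts[OF t W] by simp
  have "rl_integral 1 (marchaud \<alpha> f) t = (LINT s:{0..t}|lborel. marchaud \<alpha> f s)"
    using rl_integral_1[OF continuous_marchaud]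
      set_borel_integral_eq_integral(2)[OF borel_integrable_atLeastAtMost'[OF continuous_marchaud]] by simp
  also have "\<dots> = (LINT u:{0..t}|lborel. u powr \<alpha> * f (t - u))"
    unfolding marchaud_def using pow dbl double by (simp add: set_integral_diff)
  also have "\<dots> = Gamma (1 + \<alpha>) * rl_integral (1 + \<alpha>) f t"
  proof -
    have "0 < Gamma (1 + \<alpha>)" using alpha by (intro Gamma_real_pos) simp
    then show ?thesis by (simp add: rl_integral_reflect)
  qed
  finally show ?thesis .
qed

text \<open>Both sides are continuous in \<open>t\<close>, so it is enough to compare them after applying \<open>J\<^sup>1\<close>; there the semigroup
law reduces everything to the case \<open>p = 1\<close>.\<close>

lemma rl_marchaud:
  assumes p: "0 < p" "0 < p + \<alpha>" and t: "0 \<le> t"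
  shows "rl_integral p (marchaud \<alpha> f) t = Gamma (1 + \<alpha>) * rl_integral (p + \<alpha>) f t"
proof -
  let ?g = "\<lambda>t. Gamma (1 + \<alpha>) * rl_integral (p + \<alpha>) f t"
  have "rl_integral p (marchaud \<alpha> f) t = ?g t"
  \<comment> \<open>\<open>t + 1\<close> instead of \<open>t\<close>, since \<open>J\<^sup>1\<close> is inverted on an interval of positive length\<close>
  proof (rule rl_integral_1_inj[where T = "t + 1" and f = "rl_integral p (marchaud \<alpha> f)" and g = ?g])
    show "continuous_on {0..t+1} (rl_integral p (marchaud \<alpha> f))"
      by (rule continuous_on_rl_integral[OF p(1) continuous_marchaud])
    show "continuous_on {0..t+1} ?g"
      by (intro continuous_intros continuous_on_rl_integral[OF p(2) continuous])
    fix s assume s: "s \<in> {0..t+1}"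
    have "rl_integral 1 (rl_integral p (marchaud \<alpha> f)) s = rl_integral p (rl_integral 1 (marchaud \<alpha> f)) s"
      using s p continuous_marchaud by (simp add: rl_integral_semigroup add.commute)
    also have "\<dots> = rl_integral p (\<lambda>t. Gamma (1 + \<alpha>) * rl_integral (1 + \<alpha>) f t) s"
      using rl_1_marchaud by (intro rl_integral_cong) auto
    also have "\<dots> = Gamma (1 + \<alpha>) * rl_integral (p + (1 + \<alpha>)) f s"
      using s p alpha continuous by (simp add: rl_integral_semigroup rl_integral_cmult)
    also have "\<dots> = Gamma (1 + \<alpha>) * rl_integral 1 (rl_integral (p + \<alpha>) f) s"
      using s p alpha continuous by (simp add: rl_integral_semigroup algebra_simps)
    finally show "rl_integral 1 (rl_integral p (marchaud \<alpha> f)) s = rl_integral 1 ?g s"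
      by (simp add: rl_integral_cmult)
  qed (use t in auto)
  then show ?thesis .
qed

end

section \<open>Riemann sums of the Marchaud form\<close>

definition uniform_partition :: "real \<Rightarrow> nat \<Rightarrow> nat \<Rightarrow> real" where
  "uniform_partition t k i = real i * t / real (Suc k)"

lemma is_partition_uniform: "0 < t \<Longrightarrow> is_partition t (Suc k) (uniform_partition t k)"
  by (simp add: is_partition_def uniform_partition_def divide_simps del: of_nat_Suc)

lemma step_function_uniform:
  assumes t: "0 < t" and u: "u \<in> {0<..t}"
  obtains i where "i < Suc k" "uniform_partition t k i < u" "u - uniform_partition t k i \<le> t / real (Suc k)"
    "\<And>c. step_function (Suc k) (uniform_partition t k) c u = c i"
proof -
  let ?n = "real (Suc k)" and ?\<tau> = "uniform_partition t k"
  define i where "i = nat (\<lceil>u * ?n / t\<rceil> - 1)"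
  have "0 < u * ?n / t" using t u by simp
  then have pos: "1 \<le> \<lceil>u * ?n / t\<rceil>" by linarith
  then have "real i = of_int \<lceil>u * ?n / t\<rceil> - 1" by (simp add: i_def)
  then have i: "real i < u * ?n / t" "u * ?n / t \<le> real i + 1" by linarith+
  have "u * ?n / t \<le> ?n" using t u by (simp add: pos_divide_le_eq mult.commute del: of_nat_Suc)
  with i(1) have ik: "i < Suc k" by linarith
  have cell: "u \<in> {?\<tau> j<..?\<tau> (Suc j)} \<longleftrightarrow> real j < u * ?n / t \<and> u * ?n / t \<le> real j + 1" for j
    using t by (auto simp: uniform_partition_def field_simps)
  have ind: "indicator {?\<tau> j<..?\<tau> (Suc j)} u = (if j = i then 1 else 0 :: real)" for j
  proof -
    have "real j < u * ?n / t \<and> u * ?n / t \<le> real j + 1 \<longleftrightarrow> j = i"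
      using i by linarith
    then show ?thesis using cell[of j] by (simp add: indicator_def)
  qed
  then have step: "step_function (Suc k) ?\<tau> c u = c i" for c
  proof -
    have "step_function (Suc k) ?\<tau> c u = (\<Sum>j<Suc k. if j = i then c j else 0)"
      unfolding step_function_def by (rule sum.cong[OF refl]) (simp only: ind, simp)
    also have "\<dots> = c i" using ik by (subst sum.delta) auto
    finally show ?thesis .
  qed
  have "?\<tau> i < u" "u \<le> ?\<tau> (Suc i)" using cell[of i] i by auto
  moreover have "?\<tau> (Suc i) = ?\<tau> i + t / ?n"
    by (simp add: uniform_partition_def add_divide_distrib distrib_right del: of_nat_Suc) (simp add: add_divide_distrib distrib_right)
  ultimately show thesis using that[OF ik _ _ step] by simp
qed

lemma step_function_tendsto:
  assumes t: "0 < t" and u: "u \<in> {0<..t}" and g: "isCont g u"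
  shows "(\<lambda>k. step_function (Suc k) (uniform_partition t k) (\<lambda>i. g (uniform_partition t k i)) u) \<longlonglongrightarrow> g u"
proof -
  have "\<exists>x. x < u \<and> u - x \<le> t / real (Suc k) \<and>
      step_function (Suc k) (uniform_partition t k) (\<lambda>i. g (uniform_partition t k i)) u = g x" for k
    using step_function_uniform[OF t u, of k] by metis
  then obtain x where x: "\<And>k. x k < u" "\<And>k. u - x k \<le> t / real (Suc k)"
    "\<And>k. step_function (Suc k) (uniform_partition t k) (\<lambda>i. g (uniform_partition t k i)) u = g (x k)"
    by metis
  have "(\<lambda>k. t / real (Suc k)) \<longlonglongrightarrow> 0"
    using LIMSEQ_Suc[OF lim_const_over_n[of t]] by simp
  then have "(\<lambda>k. x k - u) \<longlonglongrightarrow> 0"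
    by (rule Lim_null_comparison[rotated]) (use x in \<open>auto intro!: always_eventually simp: abs_if\<close>)
  then have "x \<longlonglongrightarrow> u" by (simp add: LIM_zero_iff)
  then show ?thesis unfolding x(3) using g by (rule isCont_tendsto_compose[rotated])
qed

lemma step_function_measurable[measurable]: "step_function n \<tau> c \<in> borel_measurable borel"
  unfolding step_function_def[abs_def] by measurable

text \<open>Abel summation. It turns the Riemann sums, which involve increments of a path of unbounded
variation, into sums that involve increments of a smooth kernel.\<close>

lemma sum_by_parts:
  fixes a g :: "nat \<Rightarrow> real"
  shows "(\<Sum>i<n. a (Suc i) * (g (Suc i) - g i)) = a n * g n - a 0 * g 0 - (\<Sum>i<n. g i * (a (Suc i) - a i))"
  by (induction n) (auto simp: algebra_simps)

lemma powr_diff_as_integral: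
  fixes x y \<alpha> :: real
  assumes "0 < x" "x \<le> y"
  shows "set_integrable lborel {x<..y} (\<lambda>u. u powr (\<alpha> - 1))"
    "\<alpha> * (LINT u:{x<..y}|lborel. u powr (\<alpha> - 1)) = y powr \<alpha> - x powr \<alpha>"
proof -
  have i: "set_integrable lborel {x..y} (\<lambda>u. u powr (\<alpha> - 1))"
    using assms by (intro borel_integrable_atLeastAtMost' continuous_intros) auto
  show "set_integrable lborel {x<..y} (\<lambda>u. u powr (\<alpha> - 1))"
    by (rule set_integrable_subset[OF i]) auto
  have "((\<lambda>u. \<alpha> * u powr (\<alpha> - 1)) has_integral (y powr \<alpha> - x powr \<alpha>)) {x..y}"
    using assms by (intro fundamental_theorem_of_calculus)
      (auto simp: has_real_derivative_iff_has_vector_derivative[symmetric] intro!: derivative_eq_intros)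
  then have "(LINT u:{x..y}|lborel. \<alpha> * u powr (\<alpha> - 1)) = y powr \<alpha> - x powr \<alpha>"
    using set_borel_integral_eq_integral(2)[OF set_integrable_mult_right[OF i, of \<alpha>]]
      integral_unique[of "\<lambda>u. \<alpha> * u powr (\<alpha> - 1)"] by metis
  moreover have "(LINT u:{x<..y}|lborel. u powr (\<alpha> - 1)) = (LINT u:{x..y}|lborel. u powr (\<alpha> - 1))"
    unfolding set_lebesgue_integral_def
  proof (rule integral_cong_AE)
    show "AE u in lborel. indicator {x<..y} u *\<^sub>R u powr (\<alpha> - 1) = indicator {x..y} u *\<^sub>R u powr (\<alpha> - 1)"
      using AE_lborel_singleton[of x] by eventually_elim (auto simp: indicator_def)
  qed auto
  ultimately show "\<alpha> * (LINT u:{x<..y}|lborel. u powr (\<alpha> - 1)) = y powr \<alpha> - x powr \<alpha>"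
    by (simp only: set_integral_mult_right)
qed

context holder_path
begin

text \<open>After reversing the order of summation and summing by parts, the increments of \<open>u powr \<alpha>\<close> are written as
integrals of \<open>\<alpha> * u powr (\<alpha> - 1)\<close>. The result is the Marchaud form in which the increment
\<open>g u = f t - f (t - u)\<close> is frozen at the left end point of each cell. The first cell, where \<open>u powr (\<alpha> - 1)\<close>
need not be integrable, contributes nothing because \<open>g 0 = 0\<close>.\<close>

lemma riemann_sum_eq:
  assumes t: "0 < t"
  defines "g \<equiv> \<lambda>u. f t - f (t - u)"
  shows "(\<Sum>i<Suc k. (t - uniform_partition t k i) powr \<alpha> *
            (f (uniform_partition t k (Suc i)) - f (uniform_partition t k i))) =
    t powr \<alpha> * f t - \<alpha> * (LINT u:{0..t}|lborel. u powr (\<alpha> - 1) *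
        step_function (Suc k) (uniform_partition t k) (\<lambda>i. g (uniform_partition t k i)) u)"
proof -
  let ?\<tau> = "uniform_partition t k"
  have reflect: "?\<tau> (Suc k - i) = t - ?\<tau> i" if "i \<le> Suc k" for i
    using that by (simp add: uniform_partition_def of_nat_diff field_simps)
  have "(\<Sum>i<Suc k. (t - ?\<tau> i) powr \<alpha> * (f (?\<tau> (Suc i)) - f (?\<tau> i))) =
     (\<Sum>i<Suc k. (t - ?\<tau> (Suc k - Suc i)) powr \<alpha> * (f (?\<tau> (Suc (Suc k - Suc i))) - f (?\<tau> (Suc k - Suc i))))"
    by (rule sum.nat_diff_reindex[symmetric])
  also have "\<dots> = (\<Sum>i<Suc k. ?\<tau> (Suc i) powr \<alpha> * (g (?\<tau> (Suc i)) - g (?\<tau> i)))"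
  proof (rule sum.cong[OF refl])
    fix i assume "i \<in> {..<Suc k}"
    then have "Suc (Suc k - Suc i) = Suc k - i" "i \<le> Suc k" "Suc i \<le> Suc k" by auto
    then show "(t - ?\<tau> (Suc k - Suc i)) powr \<alpha> * (f (?\<tau> (Suc (Suc k - Suc i))) - f (?\<tau> (Suc k - Suc i)))
      = ?\<tau> (Suc i) powr \<alpha> * (g (?\<tau> (Suc i)) - g (?\<tau> i))"
      using reflect[of "Suc i"] reflect[of i] by (simp only: g_def) simp
  qed
  also have "\<dots> = ?\<tau> (Suc k) powr \<alpha> * g (?\<tau> (Suc k)) - ?\<tau> 0 powr \<alpha> * g (?\<tau> 0) -
      (\<Sum>i<Suc k. g (?\<tau> i) * (?\<tau> (Suc i) powr \<alpha> - ?\<tau> i powr \<alpha>))"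
    by (rule sum_by_parts[where a = "\<lambda>i. ?\<tau> i powr \<alpha>" and g = "\<lambda>i. g (?\<tau> i)"])
  also have "?\<tau> (Suc k) powr \<alpha> * g (?\<tau> (Suc k)) - ?\<tau> 0 powr \<alpha> * g (?\<tau> 0) = t powr \<alpha> * f t"
    by (simp add: uniform_partition_def g_def start del: of_nat_Suc)
  also have "(\<Sum>i<Suc k. g (?\<tau> i) * (?\<tau> (Suc i) powr \<alpha> - ?\<tau> i powr \<alpha>)) =
      \<alpha> * (LINT u:{0..t}|lborel. u powr (\<alpha> - 1) * step_function (Suc k) ?\<tau> (\<lambda>i. g (?\<tau> i)) u)"
  proof -
    let ?h = "\<lambda>i u. g (?\<tau> i) * (indicator {?\<tau> i<..?\<tau> (Suc i)} u *\<^sub>R u powr (\<alpha> - 1))"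
    have cell: "0 < ?\<tau> i" "?\<tau> i \<le> ?\<tau> (Suc i)" "?\<tau> (Suc i) \<le> t" if "i < Suc k" "i \<noteq> 0" for i
      using that t mult_right_mono[of "real (Suc i)" "real (Suc k)" t]
      by (auto simp: uniform_partition_def divide_right_mono field_simps)
    have h: "integrable lborel (?h i) \<and> \<alpha> * (LINT u|lborel. ?h i u) = g (?\<tau> i) * (?\<tau> (Suc i) powr \<alpha> - ?\<tau> i powr \<alpha>)"
      if "i < Suc k" for i
    proof (cases "i = 0")
      case True
      then have "g (?\<tau> i) = 0" by (simp add: g_def uniform_partition_def)
      then show ?thesis by simp
    next
      case False
      note p = powr_diff_as_integral[OF cell(1,2)[OF that False], of \<alpha>]
      show ?thesis
        using p(1) unfolding p(2)[symmetric] by (simp add: set_integrable_def set_lebesgue_integral_def)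
    qed
    have "(LINT u:{0..t}|lborel. u powr (\<alpha> - 1) * step_function (Suc k) ?\<tau> (\<lambda>i. g (?\<tau> i)) u) =
      (LINT u|lborel. (\<Sum>i<Suc k. ?h i u))"
      unfolding set_lebesgue_integral_def
    proof (rule Bochner_Integration.integral_cong[OF refl])
      fix u :: real
      have "indicator {0..t} u *\<^sub>R (u powr (\<alpha> - 1) * (g (?\<tau> i) * indicator {?\<tau> i<..?\<tau> (Suc i)} u)) = ?h i u"
        if "i < Suc k" for i
      proof (cases "i = 0")
        case True
        then have "g (?\<tau> i) = 0" by (simp add: g_def uniform_partition_def)
        then show ?thesis by simp
      next
        case False
        then show ?thesis using cell[OF that False] by (auto simp: indicator_def)
      qed
      then show "indicator {0..t} u *\<^sub>R (u powr (\<alpha> - 1) * step_function (Suc k) ?\<tau> (\<lambda>i. g (?\<tau> i)) u) = (\<Sum>i<Suc k. ?h i u)"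
        unfolding step_function_def sum_distrib_left scaleR_sum_right by (intro sum.cong) auto
    qed
    also have "\<dots> = (\<Sum>i<Suc k. LINT u|lborel. ?h i u)"
      using h by (intro Bochner_Integration.integral_sum) auto
    finally have eq: "(LINT u:{0..t}|lborel. u powr (\<alpha> - 1) * step_function (Suc k) ?\<tau> (\<lambda>i. g (?\<tau> i)) u) =
      (\<Sum>i<Suc k. LINT u|lborel. ?h i u)" .
    show ?thesis
      unfolding eq sum_distrib_left
      by (intro sum.cong[OF refl] conjunct2[OF h, symmetric]) (simp only: lessThan_iff)
  qed
  finally show ?thesis .
qed

text \<open>The frozen increment in the cell of \<open>u\<close> is at most \<open>C * u powr \<eta>\<close> because its argument lies to the left of
\<open>u\<close>; so the dominating function of the Marchaud form also dominates the Riemann sums.\<close>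

lemma riemann_sums_tendsto_marchaud:
  assumes t: "0 < t"
  shows "(\<lambda>k. \<Sum>i<Suc k. (t - uniform_partition t k i) powr \<alpha> *
            (f (uniform_partition t k (Suc i)) - f (uniform_partition t k i))) \<longlonglongrightarrow> marchaud \<alpha> f t"
  unfolding riemann_sum_eq[OF t] marchaud_def
proof (intro tendsto_diff tendsto_const tendsto_mult)
  let ?g = "\<lambda>u. f t - f (t - u)"
  let ?s = "\<lambda>k. step_function (Suc k) (uniform_partition t k) (\<lambda>i. ?g (uniform_partition t k i))"
  show "(\<lambda>k. LINT u:{0..t}|lborel. u powr (\<alpha> - 1) * ?s k u) \<longlonglongrightarrow> (LINT u:{0..t}|lborel. u powr (\<alpha> - 1) * ?g u)"
    unfolding set_lebesgue_integral_def
  proof (rule integral_dominated_convergence)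
    show "integrable lborel (\<lambda>u. indicator {0..t} u *\<^sub>R (C * u powr (\<alpha> - 1 + \<eta>)))"
      using dominating_integrable t by (simp add: set_integrable_def)
    have cont: "isCont ?g u" for u
    proof -
      have "isCont f (t - u)" using continuous[of UNIV] by (simp add: continuous_on_eq_continuous_at)
      then show ?thesis by (intro continuous_diff continuous_const isCont_o2[where f = "\<lambda>u. t - u" and g = f] continuous_ident)
    qed
    show "AE u in lborel. (\<lambda>k. indicator {0..t} u *\<^sub>R (u powr (\<alpha> - 1) * ?s k u)) \<longlonglongrightarrow>
        indicator {0..t} u *\<^sub>R (u powr (\<alpha> - 1) * ?g u)"
      using AE_lborel_singleton[of 0]
    proof eventually_elim
      case (elim u)
      show ?case
      proof (cases "u \<in> {0..t}")
        case True
        then show ?thesis using elim by (intro tendsto_intros step_function_tendsto[OF t _ cont]) auto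
      qed simp
    qed
    show "AE u in lborel. norm (indicator {0..t} u *\<^sub>R (u powr (\<alpha> - 1) * ?s k u)) \<le>
        indicator {0..t} u *\<^sub>R (C * u powr (\<alpha> - 1 + \<eta>))" for k
    proof (rule AE_I2)
      fix u :: real
      show "norm (indicator {0..t} u *\<^sub>R (u powr (\<alpha> - 1) * ?s k u)) \<le>
        indicator {0..t} u *\<^sub>R (C * u powr (\<alpha> - 1 + \<eta>))"
      proof (cases "u \<in> {0<..t}")
        case True
        obtain i where i: "uniform_partition t k i < u" "?s k u = ?g (uniform_partition t k i)"
          using step_function_uniform[OF t True, of k] by metis
        have "0 \<le> uniform_partition t k i" using t by (simp add: uniform_partition_def)
        then have "\<bar>?s k u\<bar> \<le> C * uniform_partition t k i powr \<eta>"
          using holder[of t "t - uniform_partition t k i"] i by simp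
        also have "\<dots> \<le> C * u powr \<eta>"
          using i \<open>0 \<le> uniform_partition t k i\<close> eta C_nonneg by (intro mult_left_mono powr_mono2) auto
        finally have "u powr (\<alpha> - 1) * \<bar>?s k u\<bar> \<le> u powr (\<alpha> - 1) * (C * u powr \<eta>)"
          by (rule mult_left_mono) simp
        then show ?thesis using True by (simp add: abs_mult powr_add mult_ac)
      qed (auto simp: indicator_def)
    qed
  qed measurable
qed

end

section \<open>Hoelder continuity of Brownian paths\<close>

text \<open>Chaining. Round \<open>x\<close> down to level \<open>n\<close>: passing to level \<open>n + 1\<close> moves by at most one dyadic step, so by
continuity \<open>g x\<close> differs from its value at the rounded point by a geometric tail \<open>E n\<close>. Two points at distance about \<open>1 / 2 ^ n\<close> are
rounded to equal or adjacent points of level \<open>n\<close>.\<close>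

lemma dyadic_holder:
  fixes g :: "real \<Rightarrow> real"
  assumes eta: "0 < \<eta>" and A: "0 \<le> A" and cont: "continuous_on {0..1} g"
    and inc: "\<And>n k. k < 2 ^ n \<Longrightarrow> \<bar>g (real (Suc k) / 2 ^ n) - g (real k / 2 ^ n)\<bar> \<le> A * (2 powr - \<eta>) ^ n"
  shows "\<exists>C. \<forall>x\<in>{0..1}. \<forall>y\<in>{0..1}. \<bar>g y - g x\<bar> \<le> C * \<bar>y - x\<bar> powr \<eta>"
proof -
  define q :: real where "q = 2 powr - \<eta>"
  have q: "0 < q" "q < 1" using eta by (auto simp: q_def powr_less_one)
  define fl where "fl n x = nat \<lfloor>2 ^ n * x\<rfloor>" for n and x :: real
  define ap where "ap n x = real (fl n x) / 2 ^ n" for n x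
  define E where "E n = A * q ^ Suc n / (1 - q)" for n
  have E_nonneg: "0 \<le> E n" for n using A q by (simp add: E_def)
  \<comment> \<open>the geometric tails telescope, so the chain from level \<open>n\<close> to any later level costs at most \<open>E n\<close>\<close>
  have E_step: "A * q ^ Suc n = E n - E (Suc n)" for n
  proof -
    have "E n - E (Suc n) = A * q ^ Suc n * (1 - q) / (1 - q)"
      by (simp add: E_def diff_divide_distrib[symmetric] algebra_simps)
    then show ?thesis using q by simp
  qed
  have fl: "real (fl n x) \<le> 2 ^ n * x" "2 ^ n * x < real (fl n x) + 1" "fl n x \<le> 2 ^ n" if "x \<in> {0..1}" for n x
  proof -
    have "0 \<le> \<lfloor>2 ^ n * x\<rfloor>" using that by simp
    then have r: "real (fl n x) = of_int \<lfloor>2 ^ n * x\<rfloor>" by (simp add: fl_def)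
    show a: "real (fl n x) \<le> 2 ^ n * x" "2 ^ n * x < real (fl n x) + 1" unfolding r by linarith+
    have "2 ^ n * x \<le> 2 ^ n" using that by simp
    from order_trans[OF a(1) this] show "fl n x \<le> 2 ^ n" by simp
  qed
  have refine: "\<bar>g (ap (Suc n) x) - g (ap n x)\<bar> \<le> A * q ^ Suc n" if x: "x \<in> {0..1}" for n x
  proof -
    have "real (fl (Suc n) x) < real (2 * fl n x + 2)" "real (2 * fl n x) < real (fl (Suc n) x + 1)"
      using fl(1,2)[OF x, of n] fl(1,2)[OF x, of "Suc n"] by auto
    then have "fl (Suc n) x < 2 * fl n x + 2" "2 * fl n x < fl (Suc n) x + 1"
      by (simp_all only: of_nat_less_iff)
    then consider "fl (Suc n) x = 2 * fl n x" | "fl (Suc n) x = Suc (2 * fl n x)" by linarith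
    then show ?thesis
    proof cases
      case 1
      then have "ap (Suc n) x = ap n x" by (simp add: ap_def)
      then show ?thesis using A q by simp
    next
      case 2
      then have "2 * fl n x < 2 ^ Suc n" using fl(3)[OF x, of "Suc n"] by simp
      from inc[OF this] show ?thesis
        using 2 by (simp add: ap_def q_def)
    qed
  qed
  have chain: "\<bar>g (ap (n + j) x) - g (ap n x)\<bar> \<le> E n - E (n + j)" if x: "x \<in> {0..1}" for n j x
  proof (induction j)
    case (Suc j)
    then show ?case using refine[OF x, of "n + j"] E_step[of "n + j"] by auto
  qed simp
  have ap_lim: "(\<lambda>n. ap n x) \<longlonglongrightarrow> x" if x: "x \<in> {0..1}" for x
  proof -
    have "norm (ap n x - x) \<le> (1 / 2) ^ n" for n
    proof -
      have eq: "x - ap n x = (2 ^ n * x - real (fl n x)) / 2 ^ n" by (simp add: ap_def diff_divide_distrib)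
      have "0 \<le> x - ap n x" "x - ap n x \<le> 1 / 2 ^ n"
        unfolding eq using fl(1,2)[OF x, of n] by (auto intro!: divide_right_mono)
      then show ?thesis by (simp add: power_one_over)
    qed
    then have "\<forall>\<^sub>F n in sequentially. norm (ap n x - x) \<le> (1 / 2) ^ n" by (intro always_eventually allI)
    moreover have "(\<lambda>n. (1 / 2 :: real) ^ n) \<longlonglongrightarrow> 0" by (intro LIMSEQ_power_zero) simp
    ultimately have "(\<lambda>n. ap n x - x) \<longlonglongrightarrow> 0" by (rule Lim_null_comparison)
    then show ?thesis by (simp add: LIM_zero_iff)
  qed
  have ap_mem: "ap n x \<in> {0..1}" if x: "x \<in> {0..1}" for n x
  proof -
    have "real (fl n x) \<le> real (2 ^ n)" using fl(3)[OF x] of_nat_le_iff by blast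
    then show ?thesis by (simp add: ap_def)
  qed
  have approx: "\<bar>g x - g (ap n x)\<bar> \<le> E n" if x: "x \<in> {0..1}" for n x
  proof -
    have "(\<lambda>m. g (ap m x)) \<longlonglongrightarrow> g x"
      using cont ap_lim[OF x] ap_mem[OF x] x by (auto simp: continuous_on_sequentially o_def)
    then have "(\<lambda>m. \<bar>g (ap (n + m) x) - g (ap n x)\<bar>) \<longlonglongrightarrow> \<bar>g x - g (ap n x)\<bar>"
      using LIMSEQ_ignore_initial_segment[of "\<lambda>m. g (ap m x)" "g x" n]
      by (intro tendsto_intros) (simp add: add.commute)
    then show ?thesis
    proof (rule LIMSEQ_le_const2)
      have "\<bar>g (ap (n + m) x) - g (ap n x)\<bar> \<le> E n" for m
        using chain[OF x, of n m] E_nonneg[of "n + m"] by linarith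
      then show "\<exists>N. \<forall>m\<ge>N. \<bar>g (ap (n + m) x) - g (ap n x)\<bar> \<le> E n" by blast
    qed
  qed
  \<comment> \<open>one step of level \<open>n\<close>, two tails \<open>E n\<close>, and \<open>2 powr \<eta>\<close> from replacing \<open>1 / 2 ^ n\<close> by \<open>2 * (y - x)\<close>\<close>
  define C where "C = A * (1 + 2 * q / (1 - q)) * 2 powr \<eta>"
  have less: "\<bar>g y - g x\<bar> \<le> C * (y - x) powr \<eta>" if x: "x \<in> {0..1}" and y: "y \<in> {0..1}" and "x < y" for x y
  proof -
    \<comment> \<open>the level at which \<open>1 / 2 ^ Suc n < y - x \<le> 1 / 2 ^ n\<close>\<close>
    define n where "n = (LEAST n. (1 / 2) ^ Suc n < y - x)"
    have "\<exists>n. (1 / 2) ^ Suc n < y - x"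
    proof -
      obtain n where n: "(1 / 2) ^ n < y - x" using real_arch_pow_inv[of "y - x" "1 / 2"] \<open>x < y\<close> by auto
      have "(1 / 2 :: real) ^ Suc n \<le> (1 / 2) ^ n" by simp
      with n show ?thesis by (meson le_less_trans)
    qed
    then have n1: "(1 / 2) ^ Suc n < y - x" unfolding n_def by (rule LeastI_ex)
    have n2: "y - x \<le> (1 / 2) ^ n"
    proof (cases n)
      case 0
      then show ?thesis using x y by simp
    next
      case (Suc m)
      then have "\<not> (1 / 2) ^ Suc m < y - x" using not_less_Least[of m "\<lambda>n. (1 / 2) ^ Suc n < y - x"] by (simp add: n_def)
      then show ?thesis using Suc by simp
    qed
    have XY: "2 ^ n * y \<le> 2 ^ n * x + 1" "2 ^ n * x < 2 ^ n * y"
      using n2 \<open>x < y\<close> by (simp_all add: field_simps)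
    have "real (fl n y) < real (fl n x + 2)" "real (fl n x) < real (fl n y + 1)"
      using fl(1)[OF y, of n] XY(1) fl(2)[OF x, of n]
        order_trans[OF fl(1)[OF x, of n] less_imp_le[OF XY(2)]] fl(2)[OF y, of n] by linarith+
    then have "fl n y < fl n x + 2" "fl n x < fl n y + 1" by (simp_all only: of_nat_less_iff)
    then consider "fl n y = fl n x" | "fl n y = Suc (fl n x)" by linarith
    then have "\<bar>g (ap n y) - g (ap n x)\<bar> \<le> A * q ^ n"
    proof cases
      case 1
      then show ?thesis using A q by (simp add: ap_def)
    next
      case 2
      then have "fl n x < 2 ^ n" using fl(3)[OF y, of n] by simp
      from inc[OF this] show ?thesis using 2 by (simp add: ap_def q_def)
    qed
    then have "\<bar>g y - g x\<bar> \<le> A * q ^ n + 2 * E n"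
      using approx[OF x, of n] approx[OF y, of n] by linarith
    also have "\<dots> = A * (1 + 2 * q / (1 - q)) * q ^ n" by (simp add: E_def algebra_simps)
    also have "q ^ n = ((1 / 2) ^ n) powr \<eta>"
      by (simp add: q_def powr_power powr_realpow[symmetric] powr_powr powr_minus power_one_over powr_divide inverse_eq_divide mult.commute)
    also have "\<dots> \<le> (2 * (y - x)) powr \<eta>"
      using n1 eta by (intro powr_mono2) auto
    also have "\<dots> = 2 powr \<eta> * (y - x) powr \<eta>" by (rule powr_mult)
    finally show ?thesis using A q by (simp add: C_def mult_left_mono mult.assoc)
  qed
  have "\<bar>g y - g x\<bar> \<le> C * \<bar>y - x\<bar> powr \<eta>" if "x \<in> {0..1}" "y \<in> {0..1}" for x y
    using less[of x y] less[of y x] that by (cases x y rule: linorder_cases) (auto simp: abs_minus_commute)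
  then show ?thesis by blast
qed

context standard_brownian_motion
begin

lemma increment_moment:
  assumes "0 \<le> s" "s < t"
  shows "integrable M (\<lambda>\<omega>. (w t \<omega> - w s \<omega>) ^ (2 * m))"
    "(LINT \<omega>|M. (w t \<omega> - w s \<omega>) ^ (2 * m)) = fact (2 * m) / (2 ^ m * fact m) * (t - s) ^ m"
proof -
  have \<sigma>: "0 < sqrt (t - s)" using assms by simp
  note D = normal_increments[OF assms]
  have nn: "0 \<le> normal_density 0 (sqrt (t - s)) x" for x by simp
  have mom: "has_bochner_integral lborel (\<lambda>x. normal_density 0 (sqrt (t - s)) x * x ^ (2 * m))
      (fact (2 * m) / ((2 / (sqrt (t - s))\<^sup>2) ^ m * fact m))"
    using normal_moment_even[OF \<sigma>, of 0 m] by simp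
  show "integrable M (\<lambda>\<omega>. (w t \<omega> - w s \<omega>) ^ (2 * m))"
    using distributed_integrable[OF D, of "\<lambda>x. x ^ (2 * m)"] mom by (auto simp: has_bochner_integral_iff)
  have "(LINT \<omega>|M. (w t \<omega> - w s \<omega>) ^ (2 * m)) = fact (2 * m) / ((2 / (sqrt (t - s))\<^sup>2) ^ m * fact m)"
    using distributed_integral[OF D, of "\<lambda>x. x ^ (2 * m)"] mom by (auto simp: has_bochner_integral_iff)
  also have "\<dots> = fact (2 * m) / (2 ^ m * fact m) * (t - s) ^ m"
    using assms by (simp add: power_divide field_simps)
  finally show "(LINT \<omega>|M. (w t \<omega> - w s \<omega>) ^ (2 * m)) = fact (2 * m) / (2 ^ m * fact m) * (t - s) ^ m" .
qed

text \<open>Choose \<open>m\<close> with \<open>m * (1 - 2 * \<eta>) > 1\<close>. The expectation of the sum over all \<open>n\<close> and \<open>k\<close> of the \<open>2 m\<close>-th powers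
of the increments, weighted by \<open>r ^ n\<close> where \<open>r = 2 powr (2 * \<eta> * m)\<close>, is a convergent geometric series.
Hence the sum is almost surely finite and bounds each of its terms.\<close>

lemma AE_dyadic_increments:
  assumes T: "0 < T" and eta: "0 < \<eta>" "\<eta> < 1 / 2"
  shows "AE \<omega> in M. \<exists>A\<ge>0. \<forall>n k. k < 2 ^ n \<longrightarrow>
    \<bar>w (T * (real (Suc k) / 2 ^ n)) \<omega> - w (T * (real k / 2 ^ n)) \<omega>\<bar> \<le> A * (2 powr - \<eta>) ^ n"
proof -
  obtain m :: nat where m: "1 / (1 - 2 * \<eta>) < real m" using reals_Archimedean2 by blast
  then have m': "1 < real m * (1 - 2 * \<eta>)" using eta by (simp add: pos_divide_less_eq)
  then have m_pos: "0 < m" by (cases m) auto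
  define r :: real where "r = 2 powr (2 * \<eta> * real m)"
  define K :: real where "K = fact (2 * m) / (2 ^ m * fact m)"
  \<comment> \<open>the ratio of the geometric series: \<open>2 ^ n\<close> increments, weight \<open>r ^ n\<close>, moments of order \<open>2 ^ (- n * m)\<close>\<close>
  define \<rho> :: real where "\<rho> = 2 * r / 2 ^ m"
  have "\<rho> = 2 powr (1 - real m * (1 - 2 * \<eta>))"
  proof -
    have "1 - real m * (1 - 2 * \<eta>) = 1 + 2 * \<eta> * real m - real m" by (simp add: algebra_simps)
    then show ?thesis by (simp only: powr_diff powr_add \<rho>_def r_def) (simp add: powr_realpow)
  qed
  then have \<rho>: "0 \<le> \<rho>" "\<rho> < 1" using m' by (auto simp: powr_less_one)
  define \<Delta> where "\<Delta> n k \<omega> = w (T * (real (Suc k) / 2 ^ n)) \<omega> - w (T * (real k / 2 ^ n)) \<omega>" for n k \<omega>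
  have [measurable]: "\<Delta> n k \<in> borel_measurable M" for n k
    unfolding \<Delta>_def[abs_def] using T by (intro borel_measurable_diff measurable_w) auto
  have mom: "integrable M (\<lambda>\<omega>. \<Delta> n k \<omega> ^ (2 * m))" "(LINT \<omega>|M. \<Delta> n k \<omega> ^ (2 * m)) = K * (T / 2 ^ n) ^ m" for n k
  proof -
    have lt: "0 \<le> T * (real k / 2 ^ n)" "T * (real k / 2 ^ n) < T * (real (Suc k) / 2 ^ n)"
      using T by (auto simp: divide_strict_right_mono)
    have eq: "T * (real (Suc k) / 2 ^ n) - T * (real k / 2 ^ n) = T / 2 ^ n"
      by (simp add: field_simps)
    show "integrable M (\<lambda>\<omega>. \<Delta> n k \<omega> ^ (2 * m))" "(LINT \<omega>|M. \<Delta> n k \<omega> ^ (2 * m)) = K * (T / 2 ^ n) ^ m"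
      using increment_moment[OF lt, of m] unfolding eq \<Delta>_def K_def by auto
  qed
  define V where "V \<omega> = (\<Sum>n. \<Sum>k<2^n. ennreal (r ^ n * \<Delta> n k \<omega> ^ (2 * m)))" for \<omega>
  have r: "0 < r" by (simp add: r_def)
  have ev: "0 \<le> x ^ (2 * m)" for x :: real by (simp add: zero_le_even_power)
  have "(\<integral>\<^sup>+ \<omega>. V \<omega> \<partial>M) = (\<Sum>n. \<Sum>k<2^n. \<integral>\<^sup>+ \<omega>. ennreal (r ^ n * \<Delta> n k \<omega> ^ (2 * m)) \<partial>M)"
    unfolding V_def by (simp add: nn_integral_suminf nn_integral_sum)
  also have "\<dots> = (\<Sum>n. ennreal (K * T ^ m * \<rho> ^ n))"
  proof (rule arg_cong[where f = suminf], rule ext)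
    fix n
    have i: "(\<integral>\<^sup>+ \<omega>. ennreal (r ^ n * \<Delta> n k \<omega> ^ (2 * m)) \<partial>M) = ennreal (r ^ n * (K * (T / 2 ^ n) ^ m))" for k
      using mom r ev by (subst nn_integral_eq_integral) auto
    have "0 \<le> r ^ n * (K * (T / 2 ^ n) ^ m)" using r T by (simp add: K_def)
    then have "(\<Sum>k<(2::nat)^n. ennreal (r ^ n * (K * (T / 2 ^ n) ^ m))) = ennreal (2 ^ n * (r ^ n * (K * (T / 2 ^ n) ^ m)))"
      by (simp add: ennreal_mult ennreal_power[symmetric])
    also have "2 ^ n * (r ^ n * (K * (T / 2 ^ n) ^ m)) = K * T ^ m * \<rho> ^ n"
      by (simp add: \<rho>_def power_divide power_mult_distrib power_mult[symmetric] mult.commute)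
    finally show "(\<Sum>k<2^n. \<integral>\<^sup>+ \<omega>. ennreal (r ^ n * \<Delta> n k \<omega> ^ (2 * m)) \<partial>M) = ennreal (K * T ^ m * \<rho> ^ n)"
      unfolding i .
  qed
  also have "\<dots> \<noteq> \<infinity>"
  proof -
    have s: "summable (\<lambda>n. K * T ^ m * \<rho> ^ n)"
      using \<rho> by (intro summable_mult summable_geometric) auto
    have nn: "0 \<le> K * T ^ m * \<rho> ^ n" for n using \<rho>(1) T by (simp add: K_def)
    show ?thesis
      unfolding suminf_ennreal_eq[OF nn summable_sums[OF s]] by simp
  qed
  finally have "AE \<omega> in M. V \<omega> \<noteq> \<infinity>"
    by (intro nn_integral_noteq_infinite) (auto simp: V_def[abs_def])
  then show ?thesis
  proof eventually_elim
    case (elim \<omega>)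
    then obtain A where A: "0 \<le> A" "V \<omega> = ennreal A" by (cases "V \<omega>") auto
    have "\<bar>\<Delta> n k \<omega>\<bar> \<le> max 1 A * (2 powr - \<eta>) ^ n" if k: "k < 2 ^ n" for n k
    proof -
      have "ennreal (r ^ n * \<Delta> n k \<omega> ^ (2 * m)) \<le> (\<Sum>k<2^n. ennreal (r ^ n * \<Delta> n k \<omega> ^ (2 * m)))"
        using k by (intro member_le_sum) auto
      also have "\<dots> = (\<Sum>n\<in>{n}. \<Sum>k<2^n. ennreal (r ^ n * \<Delta> n k \<omega> ^ (2 * m)))" by simp
      also have "\<dots> \<le> V \<omega>" unfolding V_def by (rule sum_le_suminf) auto
      finally have "r ^ n * \<Delta> n k \<omega> ^ (2 * m) \<le> A" using A by (simp add: ennreal_le_iff)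
      \<comment> \<open>the root of order \<open>2 * m\<close> is avoided: a base that is at least \<open>1\<close> dominates \<open>A\<close> after taking powers\<close>
      also have "A \<le> max 1 A ^ (2 * m)"
        using m_pos by (intro order_trans[OF _ self_le_power]) auto
      finally have "\<Delta> n k \<omega> ^ (2 * m) \<le> max 1 A ^ (2 * m) / r ^ n"
        using r by (simp add: pos_le_divide_eq mult.commute)
      also have "\<dots> = (max 1 A * (2 powr - \<eta>) ^ n) ^ (2 * m)"
      proof -
        have "1 / r ^ n = ((2 powr - \<eta>) ^ n) ^ (2 * m)"
          by (simp add: r_def powr_power powr_minus_divide[symmetric] algebra_simps)
        then show ?thesis by (simp add: power_mult_distrib divide_inverse)
      qed
      finally have "\<bar>\<Delta> n k \<omega>\<bar> ^ (2 * m) \<le> (max 1 A * (2 powr - \<eta>) ^ n) ^ (2 * m)"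
        by (simp add: power_even_abs)
      then show ?thesis using m_pos by (subst (asm) power_mono_iff) auto
    qed
    then show ?case unfolding \<Delta>_def by (intro exI[of _ "max 1 A"]) auto
  qed
qed

text \<open>The time change \<open>x \<mapsto> T * x\<close> carries the dyadic points of \<open>[0, 1]\<close> to \<open>[0, T]\<close>.\<close>

lemma AE_holder:
  assumes T: "0 < T" and eta: "0 < \<eta>" "\<eta> < 1 / 2"
  shows "AE \<omega> in M. \<exists>C. \<forall>s\<in>{0..T}. \<forall>t\<in>{0..T}. \<bar>w t \<omega> - w s \<omega>\<bar> \<le> C * \<bar>t - s\<bar> powr \<eta>"
  using AE_dyadic_increments[OF assms] continuous_paths
proof eventually_elim
  case (elim \<omega>)
  obtain A where A: "A \<ge> 0" "\<And>n k. k < 2 ^ n \<Longrightarrow>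
    \<bar>w (T * (real (Suc k) / 2 ^ n)) \<omega> - w (T * (real k / 2 ^ n)) \<omega>\<bar> \<le> A * (2 powr - \<eta>) ^ n"
    using elim(1) by blast
  have "continuous_on {0..1} (\<lambda>x. w (T * x) \<omega>)"
    using T by (intro continuous_on_compose2[OF elim(2)] continuous_intros) auto
  from dyadic_holder[OF eta(1) A(1) this A(2)] obtain C where
    C: "\<And>x y. x \<in> {0..1} \<Longrightarrow> y \<in> {0..1} \<Longrightarrow> \<bar>w (T * y) \<omega> - w (T * x) \<omega>\<bar> \<le> C * \<bar>y - x\<bar> powr \<eta>"
    by blast
  have "\<bar>w t \<omega> - w s \<omega>\<bar> \<le> C / T powr \<eta> * \<bar>t - s\<bar> powr \<eta>" if "s \<in> {0..T}" "t \<in> {0..T}" for s t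
  proof -
    have "\<bar>t / T - s / T\<bar> = \<bar>t - s\<bar> / T" using T by (simp add: diff_divide_distrib[symmetric])
    then show ?thesis
      using C[of "s / T" "t / T"] that T by (simp add: powr_divide)
  qed
  then show ?case by blast
qed

lemma increment_second_moment:
  assumes "0 \<le> s" "0 \<le> t"
  shows "integrable M (\<lambda>\<omega>. (w t \<omega> - w s \<omega>)\<^sup>2)" "(LINT \<omega>|M. (w t \<omega> - w s \<omega>)\<^sup>2) = \<bar>t - s\<bar>"
  using increment_moment[of s t 1] increment_moment[of t s 1] assms
  by (cases s t rule: linorder_cases; simp add: power2_commute[of "w t _"])+

text \<open>By polarization the product of two increments is a combination of four squared increments. Its
expectation is therefore a combination of four distances, which is the length of the overlap of the
two intervals.\<close>

lemma increment_covariance: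
  assumes "0 \<le> a" "a \<le> b" "0 \<le> c" "c \<le> d"
  shows "integrable M (\<lambda>\<omega>. (w b \<omega> - w a \<omega>) * (w d \<omega> - w c \<omega>))"
    "(LINT \<omega>|M. (w b \<omega> - w a \<omega>) * (w d \<omega> - w c \<omega>)) =
       (LINT s|lborel. indicator {a<..b} s * indicator {c<..d} s)"
proof -
  have nn: "0 \<le> a" "0 \<le> b" "0 \<le> c" "0 \<le> d" using assms by linarith+
  have m: "has_bochner_integral M (\<lambda>\<omega>. (w t \<omega> - w s \<omega>)\<^sup>2) \<bar>t - s\<bar>" if "0 \<le> s" "0 \<le> t" for s t
    using increment_second_moment[OF that] by (simp add: has_bochner_integral_iff)
  have pol: "(w b \<omega> - w a \<omega>) * (w d \<omega> - w c \<omega>) =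
     ((w b \<omega> - w c \<omega>)\<^sup>2 + (w a \<omega> - w d \<omega>)\<^sup>2 - (w b \<omega> - w d \<omega>)\<^sup>2 - (w a \<omega> - w c \<omega>)\<^sup>2) / 2" for \<omega>
    by (simp add: power2_eq_square algebra_simps)
  have "has_bochner_integral M (\<lambda>\<omega>. ((w b \<omega> - w c \<omega>)\<^sup>2 + (w a \<omega> - w d \<omega>)\<^sup>2 -
      (w b \<omega> - w d \<omega>)\<^sup>2 - (w a \<omega> - w c \<omega>)\<^sup>2) / 2) ((\<bar>b - c\<bar> + \<bar>a - d\<bar> - \<bar>b - d\<bar> - \<bar>a - c\<bar>) / 2)"
    by (intro has_bochner_integral_divide_zero has_bochner_integral_diff has_bochner_integral_add m nn)
  then have h: "has_bochner_integral M (\<lambda>\<omega>. (w b \<omega> - w a \<omega>) * (w d \<omega> - w c \<omega>))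
      ((\<bar>b - c\<bar> + \<bar>a - d\<bar> - \<bar>b - d\<bar> - \<bar>a - c\<bar>) / 2)"
    unfolding pol .
  then show "integrable M (\<lambda>\<omega>. (w b \<omega> - w a \<omega>) * (w d \<omega> - w c \<omega>))"
    by (simp add: has_bochner_integral_iff)
  have "(LINT \<omega>|M. (w b \<omega> - w a \<omega>) * (w d \<omega> - w c \<omega>)) = (\<bar>b - c\<bar> + \<bar>a - d\<bar> - \<bar>b - d\<bar> - \<bar>a - c\<bar>) / 2"
    using h by (simp add: has_bochner_integral_iff)
  also have "\<dots> = max 0 (min b d - max a c)"
    using assms by (auto simp: abs_if max_def min_def)
  also have "\<dots> = (LINT s|lborel. indicator {max a c<..min b d} s)"
    by (cases "max a c \<le> min b d") (auto simp: max_def min_def)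
  also have "\<dots> = (LINT s|lborel. indicator {a<..b} s * indicator {c<..d} s)"
    by (intro Bochner_Integration.integral_cong) (auto simp: indicator_def)
  finally show "(LINT \<omega>|M. (w b \<omega> - w a \<omega>) * (w d \<omega> - w c \<omega>)) =
       (LINT s|lborel. indicator {a<..b} s * indicator {c<..d} s)" .
qed

end

section \<open>Wiener integrals as limits of step integrals\<close>

lemma square_integrable_diff:
  fixes f g :: "'b \<Rightarrow> real"
  assumes [measurable]: "f \<in> borel_measurable M" "g \<in> borel_measurable M"
    and f: "integrable M (\<lambda>x. (f x)\<^sup>2)" and g: "integrable M (\<lambda>x. (g x)\<^sup>2)"
  shows "integrable M (\<lambda>x. (f x - g x)\<^sup>2)"
    and "(LINT x|M. (f x - g x)\<^sup>2) \<le> 2 * (LINT x|M. (f x)\<^sup>2) + 2 * (LINT x|M. (g x)\<^sup>2)"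
proof -
  have bound: "(f x - g x)\<^sup>2 \<le> 2 * (f x)\<^sup>2 + 2 * (g x)\<^sup>2" for x
    using sum_squares_ge_zero[of "f x + g x" 0] by (simp add: power2_eq_square algebra_simps)
  have i: "integrable M (\<lambda>x. 2 * (f x)\<^sup>2 + 2 * (g x)\<^sup>2)"
    using f g by (intro Bochner_Integration.integrable_add integrable_mult_right)
  show d: "integrable M (\<lambda>x. (f x - g x)\<^sup>2)"
    by (rule Bochner_Integration.integrable_bound[OF i]) (auto intro!: AE_I2 order_trans[OF bound])
  have "(LINT x|M. (f x - g x)\<^sup>2) \<le> (LINT x|M. 2 * (f x)\<^sup>2 + 2 * (g x)\<^sup>2)"
    by (rule integral_mono[OF d i bound])
  then show "(LINT x|M. (f x - g x)\<^sup>2) \<le> 2 * (LINT x|M. (f x)\<^sup>2) + 2 * (LINT x|M. (g x)\<^sup>2)"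
    using f g by simp
qed

lemma square_integral_triangle:
  fixes f g h :: "'b \<Rightarrow> real"
  assumes "f \<in> borel_measurable M" "g \<in> borel_measurable M" "h \<in> borel_measurable M"
    and "integrable M (\<lambda>x. (f x - g x)\<^sup>2)" "integrable M (\<lambda>x. (h x - g x)\<^sup>2)"
  shows "(LINT x|M. (f x - h x)\<^sup>2) \<le> 2 * (LINT x|M. (f x - g x)\<^sup>2) + 2 * (LINT x|M. (h x - g x)\<^sup>2)"
  using square_integrable_diff(2)[of "\<lambda>x. f x - g x" M "\<lambda>x. h x - g x"] assms
  by (simp add: borel_measurable_diff)

lemma is_partition_bounds:
  assumes "is_partition t n \<tau>" "i \<le> n"
  shows "0 \<le> \<tau> i" "\<tau> i \<le> t"
proof -
  show "0 \<le> \<tau> i" using assms(2)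
  proof (induction i)
    case (Suc i)
    then have "\<tau> i < \<tau> (Suc i)" using assms(1) by (auto simp: is_partition_def)
    then show ?case using Suc by simp
  qed (use assms(1) in \<open>simp add: is_partition_def\<close>)
  show "\<tau> i \<le> t" using assms(2)
  proof (induction rule: inc_induct)
    case (step k)
    then have "\<tau> k < \<tau> (Suc k)" using assms(1) by (auto simp: is_partition_def)
    then show ?case using step by simp
  qed (use assms(1) in \<open>simp add: is_partition_def\<close>)
qed

text \<open>All cells of a partition of \<open>[0, t]\<close> lie inside \<open>[0, t]\<close>, so integrals over \<open>[0, t]\<close> and over the whole
line agree for step functions.\<close>

lemma step_function_support:
  assumes "is_partition t n \<tau>"
  shows "indicator {0..t} s * step_function n \<tau> c s = step_function n \<tau> c s"
  unfolding step_function_def sum_distrib_left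
proof (rule sum.cong[OF refl])
  fix i assume "i \<in> {..<n}"
  then have "0 \<le> \<tau> i" "\<tau> (Suc i) \<le> t" using is_partition_bounds[OF assms] by auto
  then show "indicator {0..t} s * (c i * indicator {\<tau> i<..\<tau> (Suc i)} s) = c i * indicator {\<tau> i<..\<tau> (Suc i)} s"
    by (auto simp: indicator_def)
qed

lemma step_function_mult:
  assumes "is_partition t n \<tau>" "is_partition t m \<sigma>"
  shows "has_bochner_integral lborel (\<lambda>s. step_function n \<tau> c s * step_function m \<sigma> d s)
    (\<Sum>i<n. \<Sum>j<m. c i * d j * (LINT s|lborel. indicator {\<tau> i<..\<tau> (Suc i)} s * indicator {\<sigma> j<..\<sigma> (Suc j)} s))"
proof -
  have i: "integrable lborel (\<lambda>s. indicator {\<tau> i<..\<tau> (Suc i)} s * indicator {\<sigma> j<..\<sigma> (Suc j)} s :: real)" for i j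
  proof -
    have "(\<lambda>s. indicator {\<tau> i<..\<tau> (Suc i)} s * indicator {\<sigma> j<..\<sigma> (Suc j)} s :: real) =
      indicator {max (\<tau> i) (\<sigma> j)<..min (\<tau> (Suc i)) (\<sigma> (Suc j))}"
      by (auto simp: indicator_def fun_eq_iff)
    moreover have "emeasure lborel {max (\<tau> i) (\<sigma> j)<..min (\<tau> (Suc i)) (\<sigma> (Suc j))} < \<infinity>"
      by (intro emeasure_bounded_finite bounded_subset[OF bounded_closed_interval greaterThanAtMost_subseteq_atLeastAtMost_iff[THEN iffD2]]) auto
    ultimately show ?thesis by simp
  qed
  have "has_bochner_integral lborel (\<lambda>s. \<Sum>i<n. \<Sum>j<m. c i * d j * (indicator {\<tau> i<..\<tau> (Suc i)} s * indicator {\<sigma> j<..\<sigma> (Suc j)} s))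
    (\<Sum>i<n. \<Sum>j<m. c i * d j * (LINT s|lborel. indicator {\<tau> i<..\<tau> (Suc i)} s * indicator {\<sigma> j<..\<sigma> (Suc j)} s))"
    by (intro has_bochner_integral_sum has_bochner_integral_mult_right has_bochner_integral_integrable i)
  moreover have "step_function n \<tau> c s * step_function m \<sigma> d s =
    (\<Sum>i<n. \<Sum>j<m. c i * d j * (indicator {\<tau> i<..\<tau> (Suc i)} s * indicator {\<sigma> j<..\<sigma> (Suc j)} s))" for s
    unfolding step_function_def sum_product by (intro sum.cong refl) (simp only: mult_ac)
  ultimately show ?thesis by (simp only:)
qed

lemma step_function_square_integrable:
  assumes "is_partition t n \<tau>"
  shows "integrable lborel (\<lambda>s. (step_function n \<tau> c s)\<^sup>2)"
  using step_function_mult[OF assms assms, of c c] by (simp add: has_bochner_integral_iff power2_eq_square)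

lemma step_function_L2_distance:
  assumes "is_partition t n \<tau>"
  shows "(LINT s:{0..t}|lborel. (step_function n \<tau> c s - f s)\<^sup>2) =
      (LINT s|lborel. (step_function n \<tau> c s - indicator {0..t} s * f s)\<^sup>2)"
  unfolding set_lebesgue_integral_def
proof (rule Bochner_Integration.integral_cong[OF refl])
  fix s :: real
  show "indicator {0..t} s *\<^sub>R (step_function n \<tau> c s - f s)\<^sup>2 = (step_function n \<tau> c s - indicator {0..t} s * f s)\<^sup>2"
    using step_function_support[OF assms, of s c] by (cases "s \<in> {0..t}") auto
qed

context standard_brownian_motion
begin

text \<open>\<open>increment_covariance\<close> covers overlapping intervals, so bilinearity gives the identity for two arbitrary
partitions directly, without a common refinement.\<close>

lemma step_integral_mult:
  assumes "is_partition t n \<tau>" "is_partition t m \<sigma>"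
  shows "has_bochner_integral M (\<lambda>\<omega>. step_integral w n \<tau> c \<omega> * step_integral w m \<sigma> d \<omega>)
    (LINT s|lborel. step_function n \<tau> c s * step_function m \<sigma> d s)"
proof -
  have p: "0 \<le> \<tau> i" "\<tau> i \<le> \<tau> (Suc i)" if "i < n" for i
    using assms(1) is_partition_bounds(1)[OF assms(1), of i] that by (auto simp: is_partition_def less_imp_le)
  have q: "0 \<le> \<sigma> i" "\<sigma> i \<le> \<sigma> (Suc i)" if "i < m" for i
    using assms(2) is_partition_bounds(1)[OF assms(2), of i] that by (auto simp: is_partition_def less_imp_le)
  have "has_bochner_integral M (\<lambda>\<omega>. \<Sum>i<n. \<Sum>j<m. c i * d j *
        ((w (\<tau> (Suc i)) \<omega> - w (\<tau> i) \<omega>) * (w (\<sigma> (Suc j)) \<omega> - w (\<sigma> j) \<omega>)))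
    (\<Sum>i<n. \<Sum>j<m. c i * d j * (LINT s|lborel. indicator {\<tau> i<..\<tau> (Suc i)} s * indicator {\<sigma> j<..\<sigma> (Suc j)} s))"
  proof (intro has_bochner_integral_sum has_bochner_integral_mult_right)
    fix i j assume "i \<in> {..<n}" "j \<in> {..<m}"
    then show "has_bochner_integral M (\<lambda>\<omega>. (w (\<tau> (Suc i)) \<omega> - w (\<tau> i) \<omega>) * (w (\<sigma> (Suc j)) \<omega> - w (\<sigma> j) \<omega>))
       (LINT s|lborel. indicator {\<tau> i<..\<tau> (Suc i)} s * indicator {\<sigma> j<..\<sigma> (Suc j)} s)"
      using increment_covariance[OF p[of i] q[of j]] by (simp add: has_bochner_integral_iff)
  qed
  moreover have "step_integral w n \<tau> c \<omega> * step_integral w m \<sigma> d \<omega> =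
    (\<Sum>i<n. \<Sum>j<m. c i * d j * ((w (\<tau> (Suc i)) \<omega> - w (\<tau> i) \<omega>) * (w (\<sigma> (Suc j)) \<omega> - w (\<sigma> j) \<omega>)))" for \<omega>
    unfolding step_integral_def sum_product by (intro sum.cong refl) (simp only: mult_ac)
  ultimately show ?thesis
    using step_function_mult[OF assms, of c d] by (simp only: has_bochner_integral_iff)
qed

lemma step_integral_measurable:
  assumes "is_partition t n \<tau>"
  shows "step_integral w n \<tau> c \<in> borel_measurable M"
  unfolding step_integral_def[abs_def]
  by (intro borel_measurable_sum borel_measurable_times borel_measurable_const borel_measurable_diff
      measurable_w is_partition_bounds(1)[OF assms]) auto

lemma step_integral_isometry:
  assumes "is_partition t n \<tau>" "is_partition t m \<sigma>"
  shows "has_bochner_integral M (\<lambda>\<omega>. (step_integral w n \<tau> c \<omega> - step_integral w m \<sigma> d \<omega>)\<^sup>2)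
    (LINT s|lborel. (step_function n \<tau> c s - step_function m \<sigma> d s)\<^sup>2)"
proof -
  let ?f = "step_function n \<tau> c" and ?g = "step_function m \<sigma> d"
  let ?S = "step_integral w n \<tau> c" and ?R = "step_integral w m \<sigma> d"
  have "has_bochner_integral M (\<lambda>\<omega>. ?S \<omega> * ?S \<omega> - 2 * (?S \<omega> * ?R \<omega>) + ?R \<omega> * ?R \<omega>)
    ((LINT s|lborel. ?f s * ?f s) - 2 * (LINT s|lborel. ?f s * ?g s) + (LINT s|lborel. ?g s * ?g s))"
    by (intro has_bochner_integral_add has_bochner_integral_diff has_bochner_integral_mult_right
        step_integral_mult[OF assms(1) assms(1)] step_integral_mult[OF assms(1) assms(2)]
        step_integral_mult[OF assms(2) assms(2)])
  moreover have "has_bochner_integral lborel (\<lambda>s. ?f s * ?f s - 2 * (?f s * ?g s) + ?g s * ?g s)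
    ((LINT s|lborel. ?f s * ?f s) - 2 * (LINT s|lborel. ?f s * ?g s) + (LINT s|lborel. ?g s * ?g s))"
    by (intro has_bochner_integral_add has_bochner_integral_diff has_bochner_integral_mult_right
        has_bochner_integral_integrable
        step_function_mult[OF assms(1) assms(1), THEN integrable.intros]
        step_function_mult[OF assms(1) assms(2), THEN integrable.intros]
        step_function_mult[OF assms(2) assms(2), THEN integrable.intros])
  moreover have "(x - y)\<^sup>2 = x * x - 2 * (x * y) + y * y" for x y :: real
    by (simp add: power2_eq_square algebra_simps)
  ultimately show ?thesis by (simp add: has_bochner_integral_iff)
qed

lemma step_integral_square_integrable:
  assumes "is_partition t n \<tau>"
  shows "integrable M (\<lambda>\<omega>. (step_integral w n \<tau> c \<omega>)\<^sup>2)"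
  using step_integral_mult[OF assms assms, of c c] by (simp add: has_bochner_integral_iff power2_eq_square)

lemma step_integral_L2_distance_le:
  assumes p: "is_partition t n \<tau>" "is_partition t m \<sigma>"
    and f: "set_borel_measurable lborel {0..t} f" "set_integrable lborel {0..t} (\<lambda>s. (f s)\<^sup>2)"
  shows "(LINT \<omega>|M. (step_integral w n \<tau> c \<omega> - step_integral w m \<sigma> d \<omega>)\<^sup>2) \<le>
    2 * (LINT s:{0..t}|lborel. (step_function n \<tau> c s - f s)\<^sup>2) +
    2 * (LINT s:{0..t}|lborel. (step_function m \<sigma> d s - f s)\<^sup>2)"
proof -
  let ?g = "\<lambda>s. indicator {0..t} s * f s"
  have g[measurable]: "?g \<in> borel_measurable lborel"
    using f(1) by (simp add: set_borel_measurable_def)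
  have g2: "integrable lborel (\<lambda>s. (?g s)\<^sup>2)"
    using f(2) unfolding set_integrable_def
    by (rule Bochner_Integration.integrable_cong[THEN iffD1, rotated 2]) (auto simp: indicator_def)
  show ?thesis
    unfolding step_function_L2_distance[OF p(1)] step_function_L2_distance[OF p(2)]
    using step_integral_isometry[OF p, of c d] square_integral_triangle[of "step_function n \<tau> c" lborel ?g "step_function m \<sigma> d"]
      square_integrable_diff(1)[OF _ g step_function_square_integrable[OF p(1)] g2]
      square_integrable_diff(1)[OF _ g step_function_square_integrable[OF p(2)] g2]
    by (simp add: has_bochner_integral_iff)
qed

text \<open>The \<open>L\<^sup>2\<close> distance of the two limits is estimated through both approximating sequences; the distance of
the step integrals is, by the isometry, the distance of step functions with the same limit \<open>f\<close>.\<close>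

lemma wiener_integral_unique:
  assumes "has_wiener_integral M w t f I" "has_wiener_integral M w t f J"
  shows "AE \<omega> in M. I \<omega> = J \<omega>"
proof -
  from assms(1) obtain N \<tau> c where 1: "\<And>k::nat. is_partition t (N k) (\<tau> k)"
    "(\<lambda>k. LINT s:{0..t}|lborel. (step_function (N k) (\<tau> k) (c k) s - f s)\<^sup>2) \<longlonglongrightarrow> 0"
    "(\<lambda>k. LINT \<omega>|M. (step_integral w (N k) (\<tau> k) (c k) \<omega> - I \<omega>)\<^sup>2) \<longlonglongrightarrow> 0"
    unfolding has_wiener_integral_def by blast
  from assms(2) obtain N' \<tau>' c' where 2: "\<And>k::nat. is_partition t (N' k) (\<tau>' k)"
    "(\<lambda>k. LINT s:{0..t}|lborel. (step_function (N' k) (\<tau>' k) (c' k) s - f s)\<^sup>2) \<longlonglongrightarrow> 0"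
    "(\<lambda>k. LINT \<omega>|M. (step_integral w (N' k) (\<tau>' k) (c' k) \<omega> - J \<omega>)\<^sup>2) \<longlonglongrightarrow> 0"
    unfolding has_wiener_integral_def by blast
  have f: "set_borel_measurable lborel {0..t} f" "set_integrable lborel {0..t} (\<lambda>s. (f s)\<^sup>2)"
    and I: "I \<in> borel_measurable M" "integrable M (\<lambda>\<omega>. (I \<omega>)\<^sup>2)"
    and J: "J \<in> borel_measurable M" "integrable M (\<lambda>\<omega>. (J \<omega>)\<^sup>2)"
    using assms by (auto simp: has_wiener_integral_def)
  define S where "S k = step_integral w (N k) (\<tau> k) (c k)" for k
  define R where "R k = step_integral w (N' k) (\<tau>' k) (c' k)" for k
  have S: "S k \<in> borel_measurable M" "integrable M (\<lambda>\<omega>. (S k \<omega>)\<^sup>2)" for k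
    unfolding S_def using 1(1) by (blast intro: step_integral_measurable step_integral_square_integrable)+
  have R: "R k \<in> borel_measurable M" "integrable M (\<lambda>\<omega>. (R k \<omega>)\<^sup>2)" for k
    unfolding R_def using 2(1) by (blast intro: step_integral_measurable step_integral_square_integrable)+
  let ?e = "\<lambda>k. LINT s:{0..t}|lborel. (step_function (N k) (\<tau> k) (c k) s - f s)\<^sup>2"
  let ?e' = "\<lambda>k. LINT s:{0..t}|lborel. (step_function (N' k) (\<tau>' k) (c' k) s - f s)\<^sup>2"
  note sq = square_integrable_diff(1)
  have le: "(LINT \<omega>|M. (I \<omega> - J \<omega>)\<^sup>2) \<le> 2 * (LINT \<omega>|M. (S k \<omega> - I \<omega>)\<^sup>2) +
      (4 * (LINT \<omega>|M. (R k \<omega> - J \<omega>)\<^sup>2) + 8 * (?e k + ?e' k))" for k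
  proof -
    have "(LINT \<omega>|M. (I \<omega> - J \<omega>)\<^sup>2) \<le> 2 * (LINT \<omega>|M. (I \<omega> - S k \<omega>)\<^sup>2) + 2 * (LINT \<omega>|M. (J \<omega> - S k \<omega>)\<^sup>2)"
      using S I J by (intro square_integral_triangle sq)
    moreover have "(LINT \<omega>|M. (J \<omega> - S k \<omega>)\<^sup>2) \<le> 2 * (LINT \<omega>|M. (J \<omega> - R k \<omega>)\<^sup>2) + 2 * (LINT \<omega>|M. (S k \<omega> - R k \<omega>)\<^sup>2)"
      using S R J by (intro square_integral_triangle sq)
    moreover have "(LINT \<omega>|M. (S k \<omega> - R k \<omega>)\<^sup>2) \<le> 2 * ?e k + 2 * ?e' k"
      unfolding S_def R_def by (rule step_integral_L2_distance_le[OF 1(1) 2(1) f])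
    moreover have "(LINT \<omega>|M. (I \<omega> - S k \<omega>)\<^sup>2) = (LINT \<omega>|M. (S k \<omega> - I \<omega>)\<^sup>2)"
      "(LINT \<omega>|M. (J \<omega> - R k \<omega>)\<^sup>2) = (LINT \<omega>|M. (R k \<omega> - J \<omega>)\<^sup>2)"
      by (simp_all only: power2_commute)
    ultimately show ?thesis by argo
  qed
  have "(\<lambda>k. 2 * (LINT \<omega>|M. (S k \<omega> - I \<omega>)\<^sup>2) + (4 * (LINT \<omega>|M. (R k \<omega> - J \<omega>)\<^sup>2) + 8 * (?e k + ?e' k)))
      \<longlonglongrightarrow> 2 * 0 + (4 * 0 + 8 * (0 + 0))"
    unfolding S_def R_def by (intro tendsto_intros 1 2)
  then have "(LINT \<omega>|M. (I \<omega> - J \<omega>)\<^sup>2) \<le> 2 * 0 + (4 * 0 + 8 * (0 + 0))"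
    by (rule LIMSEQ_le_const) (intro exI[of _ 0] allI impI le)
  then have "(LINT \<omega>|M. (I \<omega> - J \<omega>)\<^sup>2) \<le> 0" by simp
  moreover have "0 \<le> (LINT \<omega>|M. (I \<omega> - J \<omega>)\<^sup>2)" by (rule Bochner_Integration.integral_nonneg) simp
  ultimately have "(LINT \<omega>|M. (I \<omega> - J \<omega>)\<^sup>2) = 0" by simp
  then have "AE \<omega> in M. (I \<omega> - J \<omega>)\<^sup>2 = 0"
    using sq[OF I(1) J(1) I(2) J(2)] by (subst (asm) integral_nonneg_eq_0_iff_AE) auto
  then show ?thesis by simp
qed

text \<open>An almost sure limit of step integrals suffices. The isometry bounds the \<open>L\<^sup>2\<close> distance of the \<open>k\<close>-th and
the \<open>m\<close>-th step integral by the distances of their step functions to \<open>f\<close>; by Fatou's lemma the bound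
survives the limit \<open>m \<longlonglongrightarrow> \<infinity>\<close>.\<close>

lemma has_wiener_integralI:
  assumes f: "set_borel_measurable lborel {0..t} f" "set_integrable lborel {0..t} (\<lambda>s. (f s)\<^sup>2)"
    and part: "\<And>k::nat. is_partition t (N k) (\<tau> k)"
    and conv: "(\<lambda>k. LINT s:{0..t}|lborel. (step_function (N k) (\<tau> k) (c k) s - f s)\<^sup>2) \<longlonglongrightarrow> 0"
    and lim: "AE \<omega> in M. (\<lambda>k. step_integral w (N k) (\<tau> k) (c k) \<omega>) \<longlonglongrightarrow> I \<omega>"
    and I[measurable]: "I \<in> borel_measurable M"
  shows "has_wiener_integral M w t f I"
proof -
  define S where "S k = step_integral w (N k) (\<tau> k) (c k)" for k
  define e where "e k = (LINT s:{0..t}|lborel. (step_function (N k) (\<tau> k) (c k) s - f s)\<^sup>2)" for k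
  have e_nonneg: "0 \<le> e k" for k
    unfolding e_def set_lebesgue_integral_def by (rule Bochner_Integration.integral_nonneg) simp
  have S[measurable]: "S k \<in> borel_measurable M" and S2: "integrable M (\<lambda>\<omega>. (S k \<omega>)\<^sup>2)" for k
    unfolding S_def using part by (blast intro: step_integral_measurable step_integral_square_integrable)+
  have cauchy: "(LINT \<omega>|M. (S k \<omega> - S m \<omega>)\<^sup>2) \<le> 2 * e k + 2 * e m" for k m
    unfolding S_def e_def by (rule step_integral_L2_distance_le[OF part part f])
  have fatou: "(\<integral>\<^sup>+ \<omega>. ennreal ((S k \<omega> - I \<omega>)\<^sup>2) \<partial>M) \<le> ennreal (2 * e k)" for k
  proof -
    have "(\<integral>\<^sup>+ \<omega>. ennreal ((S k \<omega> - I \<omega>)\<^sup>2) \<partial>M) = (\<integral>\<^sup>+ \<omega>. liminf (\<lambda>m. ennreal ((S k \<omega> - S m \<omega>)\<^sup>2)) \<partial>M)"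
    proof (rule nn_integral_cong_AE)
      show "AE \<omega> in M. ennreal ((S k \<omega> - I \<omega>)\<^sup>2) = liminf (\<lambda>m. ennreal ((S k \<omega> - S m \<omega>)\<^sup>2))"
        using lim
      proof eventually_elim
        case (elim \<omega>)
        then have "(\<lambda>m. ennreal ((S k \<omega> - S m \<omega>)\<^sup>2)) \<longlonglongrightarrow> ennreal ((S k \<omega> - I \<omega>)\<^sup>2)"
          unfolding S_def by (intro tendsto_intros tendsto_ennrealI)
        then show ?case by (rule lim_imp_Liminf[OF trivial_limit_sequentially, symmetric])
      qed
    qed
    also have "\<dots> \<le> liminf (\<lambda>m. \<integral>\<^sup>+ \<omega>. ennreal ((S k \<omega> - S m \<omega>)\<^sup>2) \<partial>M)"
      by (rule nn_integral_liminf) measurable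
    also have "\<dots> \<le> liminf (\<lambda>m. ennreal (2 * e k + 2 * e m))"
    proof (rule Liminf_mono, rule always_eventually, rule allI)
      fix m
      have "(\<integral>\<^sup>+ \<omega>. ennreal ((S k \<omega> - S m \<omega>)\<^sup>2) \<partial>M) = ennreal (LINT \<omega>|M. (S k \<omega> - S m \<omega>)\<^sup>2)"
        using square_integrable_diff(1)[OF S S S2 S2] by (intro nn_integral_eq_integral) auto
      then show "(\<integral>\<^sup>+ \<omega>. ennreal ((S k \<omega> - S m \<omega>)\<^sup>2) \<partial>M) \<le> ennreal (2 * e k + 2 * e m)"
        using cauchy by (simp add: ennreal_leI)
    qed
    also have "\<dots> = ennreal (2 * e k)"
    proof (rule lim_imp_Liminf)
      have "(\<lambda>m. 2 * e k + 2 * e m) \<longlonglongrightarrow> 2 * e k + 2 * 0"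
        using conv unfolding e_def by (intro tendsto_intros)
      then show "(\<lambda>m. ennreal (2 * e k + 2 * e m)) \<longlonglongrightarrow> ennreal (2 * e k)"
        by (intro tendsto_ennrealI) simp
    qed simp
    finally show ?thesis .
  qed
  have int: "integrable M (\<lambda>\<omega>. (S k \<omega> - I \<omega>)\<^sup>2)" for k
    by (rule integrableI_bounded) (use fatou[of k] in \<open>auto simp: le_less_trans\<close>)
  have le: "(LINT \<omega>|M. (S k \<omega> - I \<omega>)\<^sup>2) \<le> 2 * e k" for k
    using fatou[of k] int[of k] e_nonneg[of k] by (subst (asm) nn_integral_eq_integral) (auto simp: ennreal_le_iff)
  have "norm (LINT \<omega>|M. (S k \<omega> - I \<omega>)\<^sup>2) \<le> 2 * e k" for k
    using le[of k] Bochner_Integration.integral_nonneg[of M "\<lambda>\<omega>. (S k \<omega> - I \<omega>)\<^sup>2"] by simp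
  then have "\<forall>\<^sub>F k in sequentially. norm (LINT \<omega>|M. (S k \<omega> - I \<omega>)\<^sup>2) \<le> 2 * e k"
    by (intro always_eventually allI)
  moreover have "(\<lambda>k. 2 * e k) \<longlonglongrightarrow> 0"
    using conv unfolding e_def by (rule tendsto_mult_right_zero)
  ultimately have L2: "(\<lambda>k. LINT \<omega>|M. (S k \<omega> - I \<omega>)\<^sup>2) \<longlonglongrightarrow> 0"
    by (rule Lim_null_comparison)
  \<comment> \<open>\<open>I\<close> is square integrable as a difference of square integrable functions\<close>
  have "integrable M (\<lambda>\<omega>. (S 0 \<omega> - (S 0 \<omega> - I \<omega>))\<^sup>2)"
    by (rule square_integrable_diff(1)[OF _ _ S2 int]) measurable
  then have "integrable M (\<lambda>\<omega>. (I \<omega>)\<^sup>2)" by simp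
  then show ?thesis
    using f I part conv L2 unfolding has_wiener_integral_def S_def by blast
qed

end

text \<open>The condition \<open>\<alpha> > - 1/2\<close> makes the kernel square integrable. Its value at a left end point is at most
\<open>(t - s) powr \<alpha>\<close> if \<open>\<alpha> < 0\<close>, and at most \<open>t powr \<alpha>\<close> if \<open>\<alpha> \<ge> 0\<close>; the sum of the two dominates in both
cases.\<close>

lemma uniform_step_functions_tendsto_powr:
  assumes t: "0 < t" and a: "- 1 / 2 < \<alpha>"
  shows "set_integrable lborel {0..t} (\<lambda>s. ((t - s) powr \<alpha>)\<^sup>2)"
    and "(\<lambda>k. LINT s:{0..t}|lborel. (step_function (Suc k) (uniform_partition t k)
        (\<lambda>i. (t - uniform_partition t k i) powr \<alpha>) s - (t - s) powr \<alpha>)\<^sup>2) \<longlonglongrightarrow> 0"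
proof -
  have sq: "((t - s) powr \<alpha>)\<^sup>2 = (t - s) powr (2 * \<alpha>)" for s
    by (simp add: power2_eq_square powr_add[symmetric])
  show K2: "set_integrable lborel {0..t} (\<lambda>s. ((t - s) powr \<alpha>)\<^sup>2)"
    unfolding sq using set_integrable_reflect_iff[of t "\<lambda>u. u powr (2 * \<alpha>)"] powr_set_integrable[of "2 * \<alpha>" t] t a
    by simp
  let ?s = "\<lambda>k. step_function (Suc k) (uniform_partition t k) (\<lambda>i. (t - uniform_partition t k i) powr \<alpha>)"
  have "(\<lambda>k. LINT s:{0..t}|lborel. (?s k s - (t - s) powr \<alpha>)\<^sup>2) \<longlonglongrightarrow> (LINT s:{0..t}|lborel. ((t - s) powr \<alpha> - (t - s) powr \<alpha>)\<^sup>2)"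
    unfolding set_lebesgue_integral_def
  proof (rule integral_dominated_convergence)
    have "set_integrable lborel {0..t} (\<lambda>s. 8 * ((t - s) powr \<alpha>)\<^sup>2 + 2 * (t powr \<alpha>)\<^sup>2)"
      by (intro set_integral_add(1) set_integrable_mult_right[OF K2] borel_integrable_atLeastAtMost' continuous_on_const)
    then show "integrable lborel (\<lambda>s. indicator {0..t} s *\<^sub>R (8 * ((t - s) powr \<alpha>)\<^sup>2 + 2 * (t powr \<alpha>)\<^sup>2))"
      by (simp add: set_integrable_def)
    show "AE s in lborel. (\<lambda>k. indicator {0..t} s *\<^sub>R (?s k s - (t - s) powr \<alpha>)\<^sup>2) \<longlonglongrightarrow>
        indicator {0..t} s *\<^sub>R ((t - s) powr \<alpha> - (t - s) powr \<alpha>)\<^sup>2"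
      using AE_lborel_singleton[of 0] AE_lborel_singleton[of t]
    proof eventually_elim
      case (elim s)
      show ?case
      proof (cases "s \<in> {0..t}")
        case True
        then have "isCont (\<lambda>s. (t - s) powr \<alpha>) s" using elim by (intro continuous_intros) auto
        then show ?thesis using True elim by (intro tendsto_intros step_function_tendsto[OF t]) auto
      qed simp
    qed
    show "AE s in lborel. norm (indicator {0..t} s *\<^sub>R (?s k s - (t - s) powr \<alpha>)\<^sup>2) \<le>
        indicator {0..t} s *\<^sub>R (8 * ((t - s) powr \<alpha>)\<^sup>2 + 2 * (t powr \<alpha>)\<^sup>2)" for k
      using AE_lborel_singleton[of 0] AE_lborel_singleton[of t]
    proof eventually_elim
      case (elim s)
      show ?case
      proof (cases "s \<in> {0..t}")
        case True
        with elim have s: "s \<in> {0<..t}" "s < t" by auto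
        obtain i where i: "uniform_partition t k i < s" "?s k s = (t - uniform_partition t k i) powr \<alpha>"
          using step_function_uniform[OF t s(1), of k] by metis
        define x where "x = uniform_partition t k i"
        have x: "0 \<le> x" "x < s" using i t by (simp_all add: uniform_partition_def x_def)
        have "(t - x) powr \<alpha> \<le> (t - s) powr \<alpha> + t powr \<alpha>"
        proof (cases "0 \<le> \<alpha>")
          case True
          then have "(t - x) powr \<alpha> \<le> t powr \<alpha>" using x s by (intro powr_mono2) auto
          then show ?thesis by (simp add: add_increasing)
        next
          case False
          then have "(t - x) powr \<alpha> \<le> (t - s) powr \<alpha>" using x s by (intro powr_mono2') auto
          then show ?thesis by (simp add: add_increasing2)
        qed
        then have "\<bar>(t - x) powr \<alpha> - (t - s) powr \<alpha>\<bar> \<le> \<bar>2 * (t - s) powr \<alpha> + t powr \<alpha>\<bar>"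
          using powr_ge_zero[of "t - x" \<alpha>] powr_ge_zero[of "t - s" \<alpha>] powr_ge_zero[of t \<alpha>] by linarith
        then have "((t - x) powr \<alpha> - (t - s) powr \<alpha>)\<^sup>2 \<le> (2 * (t - s) powr \<alpha> + t powr \<alpha>)\<^sup>2"
          by (simp only: abs_le_square_iff)
        also have "\<dots> \<le> 8 * ((t - s) powr \<alpha>)\<^sup>2 + 2 * (t powr \<alpha>)\<^sup>2"
          using zero_le_power2[of "2 * (t - s) powr \<alpha> - t powr \<alpha>"] by (simp add: power2_eq_square algebra_simps)
        finally show ?thesis using True i by (simp add: x_def)
      qed simp
    qed
  qed measurable
  then show "(\<lambda>k. LINT s:{0..t}|lborel. (?s k s - (t - s) powr \<alpha>)\<^sup>2) \<longlonglongrightarrow> 0" by simp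
qed

section \<open>The solution of the fractional equation\<close>

lemma frac_J_continuous:
  assumes "0 < T" and f: "continuous_on {0..T} f" and t: "t \<in> {0..T}"
  shows "frac_J p f t = rl_integral p (\<lambda>s. f s - f 0) t"
proof -
  have "(f \<longlongrightarrow> f 0) (at 0 within {0..T})"
    using f assms(1) by (simp add: continuous_on)
  then have "(f \<longlongrightarrow> f 0) (at_right 0)"
    using assms(1) by (simp add: at_within_Icc_at_right)
  then have "Lim (at_right 0) f = f 0" by (intro tendsto_Lim) auto
  then show ?thesis by (simp add: frac_J_def rl_integral_def)
qed

text \<open>Abel's inversion: \<open>J\<^sup>1\<^sup>-\<^sup>p\<close> applied to \<open>J\<^sup>p\<close> gives \<open>J\<^sup>1\<close>.\<close>

lemma rl_integral_inj:
  assumes p: "0 < p" "p < 1" and T: "0 < T" and f: "continuous_on {0..T} f" and g: "continuous_on {0..T} g"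
    and eq: "\<And>t. t \<in> {0..T} \<Longrightarrow> rl_integral p f t = rl_integral p g t" and t: "t \<in> {0..T}"
  shows "f t = g t"
proof (rule rl_integral_1_inj[OF f g _ t T])
  fix s assume s: "s \<in> {0..T}"
  have sub: "continuous_on {0..s} f" "continuous_on {0..s} g"
    using f g s by (auto elim: continuous_on_subset)
  have "rl_integral (1 - p) (rl_integral p f) s = rl_integral (1 - p) (rl_integral p g) s"
    by (rule rl_integral_cong) (use eq s in auto)
  then show "rl_integral 1 f s = rl_integral 1 g s"
    using p s sub by (simp add: rl_integral_semigroup)
qed

lemma continuous_on_eq_on_rationals:
  fixes f g :: "real \<Rightarrow> real"
  assumes T: "0 < T" and "continuous_on {0..T} f" "continuous_on {0..T} g"
    and eq: "\<forall>s\<in>{0<..<T} \<inter> \<rat>. f s = g s" and t: "t \<in> {0..T}"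
  shows "f t = g t"
proof -
  have cl: "closure ({0<..<T} \<inter> \<rat>) = {0..T}"
    using closure_open_Int_superset[of "{0<..<T}" \<rat>] T by (simp add: Rats_closure_real)
  have "f t - g t = 0"
  proof (rule continuous_constant_on_closure[where S = "{0<..<T} \<inter> \<rat>" and f = "\<lambda>t. f t - g t"])
    show "continuous_on (closure ({0<..<T} \<inter> \<rat>)) (\<lambda>t. f t - g t)"
      unfolding cl using assms(2,3) by (intro continuous_intros)
  qed (use eq t cl in auto)
  then show ?thesis by simp
qed

text \<open>Clamping to \<open>[0, T]\<close> is a contraction, so it preserves the Hoelder condition. The bound has to be
monotone in \<open>\<bar>t - s\<bar>\<close> for this, hence the absolute value of \<open>C\<close>.\<close>

lemma holder_path_ext_cont:
  assumes T: "0 < T" and "-1 < \<alpha>" "0 < \<eta>" "0 < \<alpha> + \<eta>" and "f 0 = 0"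
    and f: "\<forall>s\<in>{0..T}. \<forall>t\<in>{0..T}. \<bar>f t - f s\<bar> \<le> C * \<bar>t - s\<bar> powr \<eta>"
  shows "holder_path (ext_cont f 0 T) \<alpha> \<eta> \<bar>C\<bar>"
proof
  fix s t :: real
  have mem: "clamp 0 T x \<in> {0..T}" for x :: real
    using clamp_in_interval[of 0 T x] T by simp
  have "\<bar>clamp 0 T t - clamp 0 T s\<bar> powr \<eta> \<le> \<bar>t - s\<bar> powr \<eta>"
    using dist_clamps_le_dist_args[of 0 T t s] assms(3) by (intro powr_mono2) (auto simp: dist_real_def)
  then have "\<bar>C\<bar> * \<bar>clamp 0 T t - clamp 0 T s\<bar> powr \<eta> \<le> \<bar>C\<bar> * \<bar>t - s\<bar> powr \<eta>"
    by (intro mult_left_mono) auto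
  moreover have "C * \<bar>clamp 0 T t - clamp 0 T s\<bar> powr \<eta> \<le> \<bar>C\<bar> * \<bar>clamp 0 T t - clamp 0 T s\<bar> powr \<eta>"
    by (intro mult_right_mono) auto
  ultimately show "\<bar>ext_cont f 0 T t - ext_cont f 0 T s\<bar> \<le> \<bar>C\<bar> * \<bar>t - s\<bar> powr \<eta>"
    using f mem[of s] mem[of t] unfolding ext_cont_def by (meson order_trans)
next
  show "ext_cont f 0 T 0 = 0" using T \<open>f 0 = 0\<close> ext_cont_cancel_cbox[of 0 0 T f] by simp
qed (use assms in auto)

lemma marchaud_0: "marchaud \<alpha> f 0 = 0"
proof -
  have "indicator {0..0} u *\<^sub>R (u powr (\<alpha> - 1) * (f 0 - f (0 - u))) = 0" for u :: real
    by (auto simp: indicator_def)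
  then have "(LINT u:{0..0}|lborel. u powr (\<alpha> - 1) * (f 0 - f (0 - u))) = 0"
    unfolding set_lebesgue_integral_def by (simp only: integral_zero)
  then show ?thesis by (simp add: marchaud_def)
qed

context standard_brownian_motion
begin

text \<open>The candidate is set to zero on a measurable null set \<open>N\<close> that contains all bad paths. Off \<open>N\<close> it is an everywhere
defined limit of measurable step integrals, which makes it measurable even if \<open>M\<close> is not complete.\<close>

lemma marchaud_wiener_integral:
  assumes T: "0 < T" and t: "t \<in> {0..T}" and a: "- 1 / 2 < \<alpha>"
    and N: "N \<in> null_sets M"
    and path: "\<And>\<omega>. \<omega> \<in> space M - N \<Longrightarrow> \<exists>\<eta> C. holder_path (ext_cont (\<lambda>s. w s \<omega>) 0 T) \<alpha> \<eta> C"
  defines "Z \<equiv> \<lambda>t \<omega>. indicator (space M - N) \<omega> * marchaud \<alpha> (ext_cont (\<lambda>s. w s \<omega>) 0 T) t"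
  shows "Z t \<in> borel_measurable M" "has_wiener_integral M w t (\<lambda>s. (t - s) powr \<alpha>) (Z t)"
proof -
  have "Z t \<in> borel_measurable M \<and> has_wiener_integral M w t (\<lambda>s. (t - s) powr \<alpha>) (Z t)"
  proof (cases "t = 0")
    case True
    have Z0: "Z t = (\<lambda>\<omega>. 0)" by (simp add: Z_def True marchaud_0)
    have "has_wiener_integral M w 0 (\<lambda>s. (0 - s) powr \<alpha>) (\<lambda>\<omega>. 0)"
    \<comment> \<open>the only partition of \<open>[0, 0]\<close> has no cells\<close>
    proof (rule has_wiener_integralI[where N = "\<lambda>_. 0" and \<tau> = "\<lambda>_ _. 0" and c = "\<lambda>_ _. 0"])
      have "indicator {0..0} s *\<^sub>R ((0 - s) powr \<alpha>)\<^sup>2 = 0"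
        "indicator {0..0} s *\<^sub>R (step_function 0 (\<lambda>_. 0) (\<lambda>_. 0) s - (0 - s) powr \<alpha>)\<^sup>2 = 0" for s :: real
        by (auto simp: indicator_def step_function_def)
      then show "set_integrable lborel {0..0} (\<lambda>s. ((0 - s) powr \<alpha>)\<^sup>2)"
        "(\<lambda>k. LINT s:{0..0}|lborel. (step_function 0 (\<lambda>_. 0) (\<lambda>_. 0) s - (0 - s) powr \<alpha>)\<^sup>2) \<longlonglongrightarrow> 0"
        by (simp_all only: set_integrable_def set_lebesgue_integral_def integral_zero integrable_zero tendsto_const)
    qed (auto simp: is_partition_def step_integral_def set_borel_measurable_def)
    then show ?thesis using Z0 True by simp
  next
    case False
    then have t0: "0 < t" using t by simp
    let ?part = "uniform_partition t"
    let ?c = "\<lambda>k i. (t - ?part k i) powr \<alpha>"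
    let ?S = "\<lambda>k. step_integral w (Suc k) (?part k) (?c k)"
    have S[measurable]: "?S k \<in> borel_measurable M" for k
      using step_integral_measurable is_partition_uniform[OF t0] by blast
    have lim: "(\<lambda>k. ?S k \<omega>) \<longlonglongrightarrow> Z t \<omega>" if \<omega>: "\<omega> \<in> space M - N" for \<omega>
    proof -
      let ?f = "ext_cont (\<lambda>s. w s \<omega>) 0 T"
      obtain \<eta> C where "holder_path ?f \<alpha> \<eta> C" using path[OF \<omega>] by blast
      then interpret holder_path ?f \<alpha> \<eta> C .
      have "?part k i \<in> {0..T}" if "i \<le> Suc k" for k i
        using is_partition_bounds[OF is_partition_uniform[OF t0], OF that] t by auto
      then have f_eq: "?f (?part k i) = w (?part k i) \<omega>" if "i \<le> Suc k" for k i
        using that ext_cont_cancel_cbox[of "?part k i" 0 T "\<lambda>s. w s \<omega>"] by (metis cbox_interval)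
      have "?S k \<omega> = (\<Sum>i<Suc k. (t - ?part k i) powr \<alpha> * (?f (?part k (Suc i)) - ?f (?part k i)))" for k
        unfolding step_integral_def by (intro sum.cong refl) (simp add: f_eq)
      then show ?thesis
        using riemann_sums_tendsto_marchaud[OF t0] \<omega> by (simp add: Z_def)
    qed
    have meas: "Z t \<in> borel_measurable M"
    proof (rule borel_measurable_LIMSEQ_real)
      have [measurable]: "space M - N \<in> sets M" using N by auto
      show "(\<lambda>\<omega>. indicator (space M - N) \<omega> * ?S k \<omega>) \<in> borel_measurable M" for k by measurable
      show "(\<lambda>k. indicator (space M - N) \<omega> * ?S k \<omega>) \<longlonglongrightarrow> Z t \<omega>" if "\<omega> \<in> space M" for \<omega>
        using lim[of \<omega>] that by (cases "\<omega> \<in> N") (auto simp: Z_def)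
    qed
    have "has_wiener_integral M w t (\<lambda>s. (t - s) powr \<alpha>) (Z t)"
    proof (rule has_wiener_integralI[where N = Suc and \<tau> = ?part and c = ?c])
      show "set_borel_measurable lborel {0..t} (\<lambda>s. (t - s) powr \<alpha>)"
        by (simp add: set_borel_measurable_def)
      show "AE \<omega> in M. (\<lambda>k. ?S k \<omega>) \<longlonglongrightarrow> Z t \<omega>"
        using AE_not_in[OF N] AE_space by eventually_elim (use lim in auto)
    qed (use uniform_step_functions_tendsto_powr[OF t0 a] is_partition_uniform[OF t0] meas in auto)
    with meas show ?thesis by simp
  qed
  then show "Z t \<in> borel_measurable M" "has_wiener_integral M w t (\<lambda>s. (t - s) powr \<alpha>) (Z t)" by auto
qed

text \<open>Besides the existence of a continuous version, this records its pathwise formula, through which the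
equation is verified.\<close>

lemma continuous_wiener_integral_marchaud:
  assumes T: "0 < T" and a: "- 1 / 2 < \<alpha>"
  obtains Z where "continuous_wiener_integral M w T (\<lambda>t s. (t - s) powr \<alpha>) Z"
    "AE \<omega> in M. \<exists>f \<eta> C. holder_path f \<alpha> \<eta> C \<and> (\<forall>t\<in>{0..T}. f t = w t \<omega> \<and> Z t \<omega> = marchaud \<alpha> f t)"
proof -
  \<comment> \<open>the midpoint between the required lower bound \<open>max 0 (- \<alpha>)\<close> and the upper bound \<open>1/2\<close>\<close>
  define \<eta> where "\<eta> = (max 0 (- \<alpha>) + 1 / 2) / 2"
  have eta: "0 < \<eta>" "\<eta> < 1 / 2" "0 < \<alpha> + \<eta>" using a by (auto simp: \<eta>_def max_def field_simps)
  have "AE \<omega> in M. \<exists>C. holder_path (ext_cont (\<lambda>s. w s \<omega>) 0 T) \<alpha> \<eta> C"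
    using AE_holder[OF T eta(1,2)] start_zero
  proof eventually_elim
    case (elim \<omega>)
    then obtain C where "\<forall>s\<in>{0..T}. \<forall>t\<in>{0..T}. \<bar>w t \<omega> - w s \<omega>\<bar> \<le> C * \<bar>t - s\<bar> powr \<eta>" by blast
    from holder_path_ext_cont[OF T _ eta(1,3) _ this] show ?case using a elim(2) by auto
  qed
  then obtain N where N: "\<And>\<omega>. \<omega> \<in> space M - N \<Longrightarrow> \<exists>C. holder_path (ext_cont (\<lambda>s. w s \<omega>) 0 T) \<alpha> \<eta> C" "N \<in> null_sets M"
    by (rule AE_E3) blast
  define Z where "Z t \<omega> = indicator (space M - N) \<omega> * marchaud \<alpha> (ext_cont (\<lambda>s. w s \<omega>) 0 T) t" for t \<omega>
  have Z: "AE \<omega> in M. \<exists>f \<eta> C. holder_path f \<alpha> \<eta> C \<and> (\<forall>t\<in>{0..T}. f t = w t \<omega> \<and> Z t \<omega> = marchaud \<alpha> f t)"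
    using AE_not_in[OF N(2)] AE_space
  proof eventually_elim
    case (elim \<omega>)
    then obtain C where "holder_path (ext_cont (\<lambda>s. w s \<omega>) 0 T) \<alpha> \<eta> C" using N(1) by blast
    moreover have "ext_cont (\<lambda>s. w s \<omega>) 0 T t = w t \<omega>" if "t \<in> {0..T}" for t
      using that ext_cont_cancel_cbox[of t 0 T "\<lambda>s. w s \<omega>"] by simp
    moreover have "Z t \<omega> = marchaud \<alpha> (ext_cont (\<lambda>s. w s \<omega>) 0 T) t" for t
      using elim by (simp add: Z_def)
    ultimately show ?case by blast
  qed
  have W: "Z t \<in> borel_measurable M" "has_wiener_integral M w t (\<lambda>s. (t - s) powr \<alpha>) (Z t)" if "t \<in> {0..T}" for t
    unfolding Z_def using marchaud_wiener_integral[OF T that a N(2)] N(1) by blast+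
  have "AE \<omega> in M. continuous_on {0..T} (\<lambda>t. Z t \<omega>)"
    using Z
  proof eventually_elim
    case (elim \<omega>)
    then obtain f \<eta> C where f: "holder_path f \<alpha> \<eta> C" "\<forall>t\<in>{0..T}. Z t \<omega> = marchaud \<alpha> f t" by blast
    have "continuous_on {0..T} (marchaud \<alpha> f)" using f(1) by (rule holder_path.continuous_marchaud)
    then show ?case using f(2) continuous_on_cong[of "{0..T}" "{0..T}" "\<lambda>t. Z t \<omega>" "marchaud \<alpha> f"] by simp
  qed
  then have "continuous_wiener_integral M w T (\<lambda>t s. (t - s) powr \<alpha>) Z"
    using W by (simp add: continuous_wiener_integral_def continuous_process_def)
  then show thesis using Z that by blast
qed

lemma continuous_wiener_integral_indistinguishable:
  assumes T: "0 < T" and "continuous_wiener_integral M w T K Z" "continuous_wiener_integral M w T K Z'"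
  shows "AE \<omega> in M. \<forall>t\<in>{0..T}. Z t \<omega> = Z' t \<omega>"
proof -
  have "AE \<omega> in M. \<forall>t\<in>{0<..<T} \<inter> \<rat>. Z t \<omega> = Z' t \<omega>"
  proof (rule AE_ball_countable')
    show "countable ({0<..<T} \<inter> \<rat>)" by (intro countable_Int2 countable_rat)
    fix t assume "t \<in> {0<..<T} \<inter> \<rat>"
    then have "t \<in> {0..T}" by auto
    then show "AE \<omega> in M. Z t \<omega> = Z' t \<omega>"
      using assms(2,3) unfolding continuous_wiener_integral_def by (intro wiener_integral_unique[where t = t and f = "K t"]) auto
  qed
  moreover have "AE \<omega> in M. continuous_on {0..T} (\<lambda>t. Z t \<omega>)" "AE \<omega> in M. continuous_on {0..T} (\<lambda>t. Z' t \<omega>)"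
    using assms(2,3) by (auto simp: continuous_wiener_integral_def continuous_process_def)
  ultimately show ?thesis
    by eventually_elim (use continuous_on_eq_on_rationals[OF T] in blast)
qed

end

lemma classical_solution_unique:
  assumes T: "0 < T" and b: "0 < \<beta>" "\<beta> < 1"
    and X: "classical_solution M w T \<beta> \<gamma> X0 X" and Y: "classical_solution M w T \<beta> \<gamma> X0 Y"
  shows "indistinguishable M T Y X"
proof -
  have "AE \<omega> in M. continuous_on {0..T} (\<lambda>t. X t \<omega>)" "AE \<omega> in M. X 0 \<omega> = X0"
    "AE \<omega> in M. \<forall>t\<in>{0..T}. frac_J (1 - \<beta>) (\<lambda>s. X s \<omega>) t = frac_J (1 - \<gamma>) (\<lambda>s. w s \<omega>) t"
    "AE \<omega> in M. continuous_on {0..T} (\<lambda>t. Y t \<omega>)" "AE \<omega> in M. Y 0 \<omega> = X0"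
    "AE \<omega> in M. \<forall>t\<in>{0..T}. frac_J (1 - \<beta>) (\<lambda>s. Y s \<omega>) t = frac_J (1 - \<gamma>) (\<lambda>s. w s \<omega>) t"
    using X Y by (auto simp: classical_solution_def continuous_process_def)
  then show ?thesis
    unfolding indistinguishable_def
  proof eventually_elim
    case (elim \<omega>)
    show ?case
    proof
      fix t assume t: "t \<in> {0..T}"
      have "Y t \<omega> - X0 = X t \<omega> - X0"
      proof (rule rl_integral_inj[of "1 - \<beta>" T "\<lambda>t. Y t \<omega> - X0" "\<lambda>t. X t \<omega> - X0"])
        fix s assume "s \<in> {0..T}"
        then show "rl_integral (1 - \<beta>) (\<lambda>t. Y t \<omega> - X0) s = rl_integral (1 - \<beta>) (\<lambda>t. X t \<omega> - X0) s"
          using frac_J_continuous[OF T elim(1), of s "1 - \<beta>"] frac_J_continuous[OF T elim(4), of s "1 - \<beta>"] elim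
          by simp
      qed (use b T t elim in \<open>auto intro!: continuous_intros\<close>)
      then show "Y t \<omega> = X t \<omega>" by simp
    qed
  qed
qed

theorem theorem3p6:
  fixes M :: "'a measure" and w :: "real \<Rightarrow> 'a \<Rightarrow> real" and T \<beta> \<gamma> X0 :: real
  assumes "standard_brownian_motion M w"
    and "T > 0"
    and "\<beta> \<in> {0<..<1}" and "\<gamma> \<in> {0<..<1}"
    and "\<beta> - \<gamma> > - 1 / 2"
  shows "(\<exists>Z. continuous_wiener_integral M w T (\<lambda>t s. (t - s) powr (\<beta> - \<gamma>)) Z) \<and>
    (\<forall>Z X. continuous_wiener_integral M w T (\<lambda>t s. (t - s) powr (\<beta> - \<gamma>)) Z \<longrightarrow>
       X = (\<lambda>t \<omega>. X0 + 1 / Gamma (1 + \<beta> - \<gamma>) * Z t \<omega>) \<longrightarrow>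
         classical_solution M w T \<beta> \<gamma> X0 X \<and>
         (\<forall>Y. classical_solution M w T \<beta> \<gamma> X0 Y \<longrightarrow> indistinguishable M T Y X))"
proof -
  interpret standard_brownian_motion M w by fact
  define \<alpha> where "\<alpha> = \<beta> - \<gamma>"
  have a: "- 1 / 2 < \<alpha>" using assms(5) by (simp add: \<alpha>_def)
  obtain Z\<^sub>0 where Z0: "continuous_wiener_integral M w T (\<lambda>t s. (t - s) powr \<alpha>) Z\<^sub>0"
    "AE \<omega> in M. \<exists>f \<eta> C. holder_path f \<alpha> \<eta> C \<and> (\<forall>t\<in>{0..T}. f t = w t \<omega> \<and> Z\<^sub>0 t \<omega> = marchaud \<alpha> f t)"
    using continuous_wiener_integral_marchaud[OF assms(2) a] by blast
  have solution: "classical_solution M w T \<beta> \<gamma> X0 (\<lambda>t \<omega>. X0 + 1 / Gamma (1 + \<alpha>) * Z t \<omega>)"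
    if Z: "continuous_wiener_integral M w T (\<lambda>t s. (t - s) powr \<alpha>) Z" for Z
  proof -
    define X where "X t \<omega> = X0 + 1 / Gamma (1 + \<alpha>) * Z t \<omega>" for t \<omega>
    have "AE \<omega> in M. continuous_on {0..T} (\<lambda>t. Z t \<omega>)"
      using Z by (simp add: continuous_wiener_integral_def continuous_process_def)
    then have cont: "AE \<omega> in M. continuous_on {0..T} (\<lambda>t. X t \<omega>)"
      unfolding X_def by eventually_elim (intro continuous_intros)
    have "X t \<in> borel_measurable M" if "t \<in> {0..T}" for t
    proof -
      have [measurable]: "Z t \<in> borel_measurable M"
        using Z that by (simp add: continuous_wiener_integral_def continuous_process_def)
      show ?thesis unfolding X_def[abs_def] by measurable
    qed
    with cont have proc: "continuous_process M T X" by (simp add: continuous_process_def)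
    \<comment> \<open>an arbitrary continuous version inherits the pathwise formula of the one constructed above\<close>
    have path: "AE \<omega> in M. \<exists>f \<eta> C. holder_path f \<alpha> \<eta> C \<and> (\<forall>t\<in>{0..T}. f t = w t \<omega> \<and> Z t \<omega> = marchaud \<alpha> f t)"
      using Z0(2) continuous_wiener_integral_indistinguishable[OF assms(2) Z0(1) Z]
    proof eventually_elim
      case (elim \<omega>)
      then show ?case by metis
    qed
    have X_0: "AE \<omega> in M. X 0 \<omega> = X0"
      using path
    proof eventually_elim
      case (elim \<omega>)
      then have "Z 0 \<omega> = 0" using assms(2) marchaud_0 by auto
      then show ?case by (simp add: X_def)
    qed
    have "AE \<omega> in M. \<forall>t\<in>{0..T}. frac_J (1 - \<beta>) (\<lambda>s. X s \<omega>) t = frac_J (1 - \<gamma>) (\<lambda>s. w s \<omega>) t"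
      using path cont X_0
    proof eventually_elim
      case (elim \<omega>)
      then obtain f \<eta> C where f: "holder_path f \<alpha> \<eta> C"
        "\<And>t. t \<in> {0..T} \<Longrightarrow> f t = w t \<omega>" "\<And>t. t \<in> {0..T} \<Longrightarrow> Z t \<omega> = marchaud \<alpha> f t" by blast
      interpret holder_path f \<alpha> \<eta> C by (rule f(1))
      have w: "continuous_on {0..T} (\<lambda>t. w t \<omega>)"
        by (rule continuous_on_eq[OF continuous f(2)])
      have Gamma_pos: "0 < Gamma (1 + \<alpha>)" using a by (intro Gamma_real_pos) simp
      show ?case
      proof
        fix t assume t: "t \<in> {0..T}"
        have "frac_J (1 - \<beta>) (\<lambda>s. X s \<omega>) t = rl_integral (1 - \<beta>) (\<lambda>s. X s \<omega> - X0) t"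
          using frac_J_continuous[OF assms(2) elim(2) t] elim(3) by simp
        also have "\<dots> = rl_integral (1 - \<beta>) (\<lambda>s. 1 / Gamma (1 + \<alpha>) * marchaud \<alpha> f s) t"
          using t f(3) by (intro rl_integral_cong) (simp add: X_def)
        also have "\<dots> = rl_integral (1 - \<beta> + \<alpha>) f t"
        proof -
          have "0 < 1 - \<beta>" "0 < 1 - \<beta> + \<alpha>" "0 \<le> t" using assms(3,4) t by (simp_all add: \<alpha>_def)
          from rl_marchaud[OF this] show ?thesis unfolding rl_integral_cmult using Gamma_pos by simp
        qed
        also have "\<dots> = rl_integral (1 - \<gamma>) (\<lambda>s. w s \<omega> - w 0 \<omega>) t"
          using t f(2)[of 0] start assms(2) f(2) by (simp add: \<alpha>_def) (intro rl_integral_cong, simp)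
        also have "\<dots> = frac_J (1 - \<gamma>) (\<lambda>s. w s \<omega>) t"
          using frac_J_continuous[OF assms(2) w t] by simp
        finally show "frac_J (1 - \<beta>) (\<lambda>s. X s \<omega>) t = frac_J (1 - \<gamma>) (\<lambda>s. w s \<omega>) t" .
      qed
    qed
    with proc X_0 have "classical_solution M w T \<beta> \<gamma> X0 X" by (simp add: classical_solution_def)
    then show ?thesis by (simp only: X_def[abs_def])
  qed
  have eq: "1 + \<beta> - \<gamma> = 1 + \<alpha>" by (simp add: \<alpha>_def)
  show ?thesis
    unfolding eq \<alpha>_def[symmetric]
  proof (intro conjI allI impI)
    show "\<exists>Z. continuous_wiener_integral M w T (\<lambda>t s. (t - s) powr \<alpha>) Z" using Z0(1) by blast
  next
    fix Z X assume ZX: "continuous_wiener_integral M w T (\<lambda>t s. (t - s) powr \<alpha>) Z"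
      "X = (\<lambda>t \<omega>. X0 + 1 / Gamma (1 + \<alpha>) * Z t \<omega>)"
    then show X: "classical_solution M w T \<beta> \<gamma> X0 X" using solution by blast
    fix Y assume "classical_solution M w T \<beta> \<gamma> X0 Y"
    with X show "indistinguishable M T Y X"
      by (rule classical_solution_unique[rotated 3]) (use assms(2,3) in auto)
  qed
qed

end
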